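(* Let $n\ge1$, $\alpha\ge1$, let $(Q_1,\ldots,Q_n)$ be an $\alpha$-conditioned $n$-tuple of positive definite real symmetric $n\times n$ matrices, and let $(P_1,\ldots,P_n)$ be a doubly stochastic $n$-tuple of positive definite matrices obtained from $(Q_1,\ldots,Q_n)$ by scaling, i.e. there exist an invertible real $n\times n$ matrix $T$ and reals $\tau_1,\ldots,\tau_n>0$ with $P_i=\tau_i T^{*}Q_iT$ for $i=1,\ldots,n$ ($T^*$ the transpose). Then $$D(P_1,\ldots,P_n)\ \le\ n^{\alpha^4}e^{-(n-1)}.$$
   Context: For real symmetric $n\times n$ matrices $Q_1,\ldots,Q_n$, the mixed discriminant is $D(Q_1,\ldots,Q_n)=\frac{\partial^n}{\partial t_1\cdots\partial t_n}\det(t_1Q_1+\cdots+t_nQ_n)$. An $n$-tuple $(Q_1,\ldots,Q_n)$ of positive semidefinite $n\times n$ matrices is doubly stochastic if $Q_1+\cdots+Q_n=I$ and $\operatorname{tr}Q_1=\cdots=\operatorname{tr}Q_n=1$. For $\alpha\ge1$, an $n$-tuple of positive definite matrices is $\alpha$-conditioned if $\lambda_{\max}(Q_i)\le\alpha\,\lambda_{\min}(Q_j)$ for all $1\le i,j\le n$ (including $i=j$). *)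

theory Defs
  imports "HOL-Analysis.Analysis"
begin

definition sym_mat :: "real^'n^'n \<Rightarrow> bool" where
  "sym_mat A \<longleftrightarrow> transpose A = A"

definition pos_def_mat :: "real^'n^'n \<Rightarrow> bool" where
  "pos_def_mat A \<longleftrightarrow> sym_mat A \<and> (\<forall>x. x \<noteq> 0 \<longrightarrow> x \<bullet> (A *v x) > 0)"

definition pos_semidef_mat :: "real^'n^'n \<Rightarrow> bool" where
  "pos_semidef_mat A \<longleftrightarrow> sym_mat A \<and> (\<forall>x. x \<bullet> (A *v x) \<ge> 0)"

definition eigenvalues_mat :: "real^'n^'n \<Rightarrow> real set" where
  "eigenvalues_mat A = {\<mu>. \<exists>v. v \<noteq> 0 \<and> A *v v = \<mu> *\<^sub>R v}"

definition lambda_max :: "real^'n^'n \<Rightarrow> real" where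
  "lambda_max A = Max (eigenvalues_mat A)"

definition lambda_min :: "real^'n^'n \<Rightarrow> real" where
  "lambda_min A = Min (eigenvalues_mat A)"

definition partial_deriv :: "'n \<Rightarrow> (('n \<Rightarrow> real) \<Rightarrow> real) \<Rightarrow> ('n \<Rightarrow> real) \<Rightarrow> real" where
  "partial_deriv i f t = deriv (\<lambda>s. f (t(i := s))) (t i)"

fun mixed_partial :: "'n list \<Rightarrow> (('n \<Rightarrow> real) \<Rightarrow> real) \<Rightarrow> ('n \<Rightarrow> real) \<Rightarrow> real" where
  "mixed_partial [] f = f"
| "mixed_partial (i # is) f = partial_deriv i (mixed_partial is f)"

(* D(Q_1,...,Q_n) = d^n/(dt_1...dt_n) det(t_1 Q_1 + ... + t_n Q_n);
   this n-th derivative of a homogeneous degree-n polynomial is constant; we evaluate at t = 0. *)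
definition mixed_discr :: "('n::finite \<Rightarrow> real^'n^'n) \<Rightarrow> real" where
  "mixed_discr Q = mixed_partial (SOME xs. distinct xs \<and> set xs = (UNIV::'n set))
      (\<lambda>t. det (\<Sum>i\<in>UNIV. t i *\<^sub>R Q i)) (\<lambda>_. 0)"

definition doubly_stochastic :: "('n::finite \<Rightarrow> real^'n^'n) \<Rightarrow> bool" where
  "doubly_stochastic P \<longleftrightarrow> (\<forall>i. pos_semidef_mat (P i)) \<and> (\<Sum>i\<in>UNIV. P i) = mat 1
     \<and> (\<forall>i. trace (P i) = 1)"

definition alpha_conditioned :: "real \<Rightarrow> ('n::finite \<Rightarrow> real^'n^'n) \<Rightarrow> bool" where
  "alpha_conditioned \<alpha> Q \<longleftrightarrow> (\<forall>i. pos_def_mat (Q i))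
     \<and> (\<forall>i j. lambda_max (Q i) \<le> \<alpha> * lambda_min (Q j))"

end

theory Submission
  imports Defs
begin

text \<open>
  For a positive definite tuple \<open>Q\<close> the ratio of \<open>det (\<Sum> t\<^sub>i Q\<^sub>i)\<close> to \<open>\<Prod> t\<^sub>i\<close> attains its minimum, the
  capacity of \<open>Q\<close>, over \<open>t > 0\<close>.  Normalising the minimising combination to the identity by a congruence
  yields a doubly stochastic tuple \<open>P\<close> with \<open>D(Q) = cap(Q) D(P)\<close>.  If \<open>\<tau>\<^sub>i q \<le> P\<^sub>i \<le> \<alpha> \<tau>\<^sub>i q\<close> for a common
  form \<open>q\<close>, then summing over \<open>i\<close> and taking traces gives \<open>P\<^sub>i \<le> \<alpha>\<^sup>2 / n\<close>.

  Write \<open>P\<^sub>j = \<Sum> \<mu>\<^sub>l b\<^sub>l b\<^sub>l\<^sup>T\<close> with \<open>\<Sum> \<mu>\<^sub>l = 1\<close>.  Replacing \<open>P\<^sub>j\<close> by \<open>b\<^sub>l b\<^sub>l\<^sup>T\<close> gives the mixed discriminant of the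
  other \<open>n - 1\<close> forms restricted to the orthogonal complement of \<open>b\<^sub>l\<close>.  Their sum there is the restriction
  of \<open>I - P\<^sub>j\<close>, so their capacity is at most its determinant, which by \<open>det A \<le> exp (tr A - dim)\<close> is at most
  \<open>exp (\<mu>\<^sub>l - 1)\<close>.  Hence passing from dimension \<open>k - 1\<close> to \<open>k\<close> costs a factor \<open>exp (\<alpha>\<^sup>2 / k - 1)\<close>, and by
  induction \<open>D(P) \<le> n powr \<alpha>\<^sup>2 * exp (- (n - 1))\<close>, which is at most the claimed bound.
\<close>

section \<open>Spectral decomposition of symmetric matrices\<close>

definition rank1 :: "real^'n \<Rightarrow> real^'n^'n" where
  "rank1 v = (\<chi> i j. v $ i * v $ j)"

lemma rank1_mult_vec: "rank1 v *v x = (v \<bullet> x) *\<^sub>R v"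
  by (simp add: vec_eq_iff rank1_def matrix_vector_mult_def inner_vec_def sum_distrib_left
      sum_distrib_right mult_ac)

lemma trace_rank1: "trace (rank1 v) = v \<bullet> v"
  by (simp add: rank1_def trace_def inner_vec_def)

lemma transpose_rank1 [simp]: "transpose (rank1 v) = rank1 v"
  by (simp add: rank1_def transpose_def vec_eq_iff mult.commute)

lemma rank1_congruence: "A ** rank1 v ** transpose A = rank1 (A *v v)"
  by (simp add: vec_eq_iff rank1_def matrix_matrix_mult_def matrix_vector_mult_def transpose_def
      sum_distrib_left sum_distrib_right mult_ac)

lemma matrix_eqI: "(\<And>x. (A :: real^'n^'m) *v x = B *v x) \<Longrightarrow> A = B"
  using matrix_eq by blast

lemma sum_scaleR_matrix_vec:
  "(\<Sum>i\<in>S. c i *\<^sub>R (A i :: real^'n^'m)) *v x = (\<Sum>i\<in>S. c i *\<^sub>R (A i *v x))"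
  by (induction S rule: infinite_finite_induct)
    (simp_all add: matrix_vector_mult_add_rdistrib scaleR_matrix_vector_assoc)

lemma linear_trace: "linear (trace :: real^'n^'n \<Rightarrow> real)"
  by (rule linearI) (simp_all add: trace_def sum.distrib sum_distrib_left)

lemma sym_mat_inner: "sym_mat A \<Longrightarrow> x \<bullet> (A *v y) = (A *v x) \<bullet> y"
  using dot_lmul_matrix[of x A y] transpose_matrix_vector[of A x] by (simp add: sym_mat_def)

text \<open>A maximiser \<open>v\<close> of the quadratic form on the unit sphere of
  \<open>W\<close> is an eigenvector: \<open>g\<close> is nonnegative on \<open>W\<close> and
  vanishes at \<open>v\<close>, while its derivative there in the direction of the residual
  \<open>y\<close> is \<open>2 * (y \<bullet> y)\<close>, so \<open>y\<close> must be zero. Allowing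
  any invariant \<open>W\<close> makes the lemma applicable to orthogonal complements.\<close>

lemma sym_eigenvector_exists:
  fixes A :: "real^'n^'n"
  assumes "sym_mat A" and W: "subspace W" and inv: "\<And>x. x \<in> W \<Longrightarrow> A *v x \<in> W"
    and w: "w \<in> W" "w \<noteq> 0"
  obtains v \<mu> where "v \<in> W" "norm v = 1" "A *v v = \<mu> *\<^sub>R v"
proof -
  let ?S = "sphere 0 1 \<inter> W"
  have "compact ?S"
    using closed_subspace[OF W] by (intro compact_Int_closed) auto
  moreover have "w /\<^sub>R norm w \<in> ?S"
    using w W by (auto simp: subspace_scale)
  moreover have "continuous_on ?S (\<lambda>x. x \<bullet> (A *v x))"
    by (intro continuous_intros linear_continuous_on matrix_vector_mul_bounded_linear)
  ultimately obtain v where v: "v \<in> ?S" and max: "\<And>x. x \<in> ?S \<Longrightarrow> x \<bullet> (A *v x) \<le> v \<bullet> (A *v v)"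
    using continuous_attains_sup[of ?S] by blast
  define \<mu> where "\<mu> = v \<bullet> (A *v v)"
  define g where "g x = \<mu> * (x \<bullet> x) - x \<bullet> (A *v x)" for x
  have g_nonneg: "g x \<ge> 0" if "x \<in> W" for x
  proof (cases "x = 0")
    case False
    have "x /\<^sub>R norm x \<in> ?S" using False that W by (auto simp: subspace_scale)
    from max[OF this] have "(x \<bullet> (A *v x)) / (norm x)^2 \<le> \<mu>"
      by (simp add: \<mu>_def matrix_vector_mult_scaleR power2_eq_square divide_inverse mult_ac)
    then show ?thesis using False by (simp add: g_def field_simps power2_norm_eq_inner)
  qed (simp add: g_def)
  have vv: "v \<bullet> v = 1" using v by (simp add: dot_square_norm)
  define y where "y = \<mu> *\<^sub>R v - A *v v"
  have yW: "y \<in> W" unfolding y_def using v inv W by (intro subspace_diff subspace_scale) auto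
  have quad: "g (v + t *\<^sub>R y) = 2 * t * (y \<bullet> y) + t^2 * g y" for t
  proof -
    have "v \<bullet> (A *v y) = y \<bullet> (A *v v)" 
      using sym_mat_inner[OF \<open>sym_mat A\<close>, of v y] by (simp add: inner_commute)
    then have "g (v + t *\<^sub>R y) = g v + 2 * t * (\<mu> * (y \<bullet> v) - y \<bullet> (A *v v)) + t^2 * g y"
      by (simp add: g_def matrix_vector_right_distrib matrix_vector_mult_scaleR inner_add_left
          inner_add_right inner_commute[of v y] algebra_simps power2_eq_square)
    moreover have "g v = 0" by (simp add: g_def vv \<mu>_def)
    moreover have "\<mu> * (y \<bullet> v) - y \<bullet> (A *v v) = y \<bullet> y"
      by (subst (3) y_def) (simp add: inner_diff_right)
    ultimately show ?thesis by simp
  qed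
  have "y \<bullet> y = 0"
  proof (rule ccontr)
    assume "y \<bullet> y \<noteq> 0"
    then have pos: "y \<bullet> y > 0" by simp
    \<comment> \<open>A negative \<open>t\<close> so small that the linear term outweighs the
      quadratic one; adding 1 keeps the denominator positive when \<open>g y\<close> is
      zero.\<close>
    define t where "t = - (y \<bullet> y) / (g y + 1)"
    have gy: "g y \<ge> 0" using g_nonneg yW by blast
    have "0 \<le> g (v + t *\<^sub>R y)"
      using v yW W by (intro g_nonneg subspace_add subspace_scale) auto
    also have "\<dots> = t * (2 * (y \<bullet> y) + t * g y)" unfolding quad by (simp add: algebra_simps power2_eq_square)
    also have "\<dots> < 0"
    proof -
      have "t < 0" using pos gy by (simp add: t_def divide_neg_pos)
      moreover have "t * g y \<ge> - (y \<bullet> y)"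
        using gy pos by (simp add: t_def field_simps)
      ultimately show ?thesis using pos by (intro mult_neg_pos) linarith+
    qed
    finally show False by simp
  qed
  then have "A *v v = \<mu> *\<^sub>R v" by (simp add: y_def)
  with v show ?thesis by (intro that[of v \<mu>]) auto
qed

text \<open>Eigenvectors are added one at a time: by symmetry the orthogonal complement of those
  already found is invariant, and it is nonzero while there are fewer of them than the
  dimension.\<close>

lemma sym_orthonormal_eigenvectors:
  fixes A :: "real^'n^'n"
  assumes "sym_mat A" "k \<le> CARD('n)"
  shows "\<exists>B. finite B \<and> card B = k \<and> pairwise orthogonal B \<and>
    (\<forall>b\<in>B. norm b = 1 \<and> (\<exists>\<mu>. A *v b = \<mu> *\<^sub>R b))"
  using assms(2)
proof (induction k)
  case 0
  show ?case by (intro exI[of _ "{}"]) auto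
next
  case (Suc k)
  then obtain B where B: "finite B" "card B = k" "pairwise orthogonal B"
    "\<And>b. b \<in> B \<Longrightarrow> norm b = 1" "\<And>b. b \<in> B \<Longrightarrow> \<exists>\<mu>. A *v b = \<mu> *\<^sub>R b"
    by auto
  have "dim B < DIM(real^'n)"
    using dim_le_card'[OF B(1)] B(2) Suc.prems by simp
  then obtain w where w: "w \<noteq> 0" "\<And>y. y \<in> span B \<Longrightarrow> orthogonal w y"
    using orthogonal_to_subspace_exists by blast
  let ?W = "{x. \<forall>b\<in>B. b \<bullet> x = 0}"
  have "subspace ?W" by (auto simp: subspace_def inner_add_right)
  moreover have "A *v x \<in> ?W" if "x \<in> ?W" for x
  proof -
    have "b \<bullet> (A *v x) = 0" if "b \<in> B" for b
      using B(5)[OF that] \<open>x \<in> ?W\<close> that by (auto simp: sym_mat_inner[OF assms(1)])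
    then show ?thesis by blast
  qed
  moreover have "w \<in> ?W"
    using w(2) span_base by (auto simp: orthogonal_def inner_commute)
  ultimately obtain v \<mu> where v: "v \<in> ?W" "norm v = 1" "A *v v = \<mu> *\<^sub>R v"
    using sym_eigenvector_exists[OF assms(1)] w(1) by blast
  have "v \<notin> B" using v by force
  then have "card (insert v B) = Suc k" using B by simp
  moreover have "pairwise orthogonal (insert v B)"
    using B(3) v(1) by (auto simp: pairwise_insert orthogonal_def inner_commute)
  ultimately show ?case using B v by (intro exI[of _ "insert v B"]) auto
qed

definition orthonormal_family :: "('n \<Rightarrow> real^'n) \<Rightarrow> bool" where
  "orthonormal_family b \<longleftrightarrow> (\<forall>i j. b i \<bullet> b j = (if i = j then 1 else 0))"

lemma spectral_theorem:
  fixes A :: "real^'n^'n"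
  assumes "sym_mat A"
  obtains b \<mu> where "orthonormal_family b" "\<And>i. A *v b i = \<mu> i *\<^sub>R b i"
proof -
  obtain B where B: "finite B" "card B = CARD('n)" "pairwise orthogonal B"
    "\<And>b. b \<in> B \<Longrightarrow> norm b = 1" "\<And>b. b \<in> B \<Longrightarrow> \<exists>\<mu>. A *v b = \<mu> *\<^sub>R b"
    using sym_orthonormal_eigenvectors[OF assms order_refl] by auto
  obtain b where b: "bij_betw b (UNIV :: 'n set) B"
    using finite_same_card_bij[of "UNIV :: 'n set" B] B by auto
  have bB: "b i \<in> B" for i using b by (auto dest: bij_betwE)
  have "\<exists>\<mu>. \<forall>i. A *v b i = \<mu> i *\<^sub>R b i" by (rule choice) (use B(5) bB in blast)
  then obtain \<mu> where "\<And>i. A *v b i = \<mu> i *\<^sub>R b i" by blast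
  moreover have "b i \<bullet> b j = (if i = j then 1 else 0)" for i j
  proof (cases "i = j")
    case False
    then have "b i \<noteq> b j" using b by (auto simp: bij_betw_def inj_on_def)
    then show ?thesis using False pairwiseD[OF B(3) bB bB] by (simp add: orthogonal_def)
  qed (simp add: dot_square_norm B(4)[OF bB])
  ultimately show ?thesis by (intro that[of b \<mu>]) (auto simp: orthonormal_family_def)
qed

text \<open>For a square matrix, orthonormal rows force orthonormal columns.\<close>

lemma orthonormal_family_matrix:
  assumes "orthonormal_family (b :: 'n::finite \<Rightarrow> _)"
  shows "transpose (\<chi> i. b i) ** (\<chi> i. b i) = mat 1"
proof -
  have "(\<chi> i. b i) ** transpose (\<chi> i. b i) = (mat 1 :: real^'n^'n)"
    using assms by (simp add: vec_eq_iff matrix_matrix_mult_def transpose_def mat_def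
        orthonormal_family_def inner_vec_def)
  then show ?thesis using matrix_left_right_inverse by blast
qed

lemma orthonormal_expansion:
  assumes "orthonormal_family (b :: 'n::finite \<Rightarrow> _)"
  shows "(\<Sum>i\<in>UNIV. (b i \<bullet> x) *\<^sub>R b i) = x"
proof -
  have "(transpose (\<chi> i. b i) ** (\<chi> i. b i)) $ j $ k = (mat 1 :: real^'n^'n) $ j $ k" for j k
    by (simp only: orthonormal_family_matrix[OF assms])
  then have dual: "(\<Sum>i\<in>UNIV. b i $ j * b i $ k) = (if j = k then 1 else 0)" for j k
    by (simp add: matrix_matrix_mult_def transpose_def mat_def)
  have "(\<Sum>i\<in>UNIV. (b i \<bullet> x) *\<^sub>R b i) $ j = x $ j" for j
  proof -
    have "(\<Sum>i\<in>UNIV. (b i \<bullet> x) *\<^sub>R b i) $ j = (\<Sum>i\<in>UNIV. \<Sum>k\<in>UNIV. x $ k * (b i $ j * b i $ k))"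
      by (simp add: inner_vec_def sum_distrib_left mult_ac)
    also have "\<dots> = (\<Sum>k\<in>UNIV. x $ k * (\<Sum>i\<in>UNIV. b i $ j * b i $ k))"
      by (subst sum.swap) (simp add: sum_distrib_left)
    finally show ?thesis by (simp add: dual if_distrib[of "\<lambda>x. _ * x"] cong: if_cong)
  qed
  then show ?thesis by (simp add: vec_eq_iff)
qed

lemma spectral_decomposition:
  assumes "orthonormal_family b" "\<And>i. A *v b i = \<mu> i *\<^sub>R b i"
  shows "A = (\<Sum>i\<in>UNIV. \<mu> i *\<^sub>R rank1 (b i))"
proof (rule matrix_eqI)
  fix x
  have "A *v x = A *v (\<Sum>i\<in>UNIV. (b i \<bullet> x) *\<^sub>R b i)"
    using orthonormal_expansion[OF assms(1)] by simp
  also have "\<dots> = (\<Sum>i\<in>UNIV. (b i \<bullet> x) *\<^sub>R \<mu> i *\<^sub>R b i)"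
    by (simp add: linear_sum[OF matrix_vector_mul_linear] matrix_vector_mult_scaleR assms(2))
  finally show "A *v x = (\<Sum>i\<in>UNIV. \<mu> i *\<^sub>R rank1 (b i)) *v x"
    by (simp add: sum_scaleR_matrix_vec rank1_mult_vec mult.commute)
qed

lemma spectral_trace:
  assumes "orthonormal_family b" "\<And>i. A *v b i = \<mu> i *\<^sub>R b i"
  shows "trace A = (\<Sum>i\<in>UNIV. \<mu> i)"
  using assms(1) by (simp add: spectral_decomposition[OF assms] linear_sum[OF linear_trace]
      linear_cmul[OF linear_trace] trace_rank1 orthonormal_family_def)

lemma spectral_det:
  assumes b: "orthonormal_family b" and e: "\<And>i. A *v b i = \<mu> i *\<^sub>R b i"
  shows "det A = (\<Prod>i\<in>UNIV. \<mu> i)"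
proof -
  let ?U = "\<chi> i. b i"
  have "A ** transpose ?U = transpose ?U ** (\<chi> i j. if i = j then \<mu> i else 0)"
  proof -
    have "(A *v b k) $ i = \<mu> k * b k $ i" for i k by (simp add: e)
    then show ?thesis
      by (simp add: vec_eq_iff matrix_matrix_mult_def transpose_def matrix_vector_mult_def mult.commute
          if_distrib[of "\<lambda>x. _ * x"] cong: if_cong)
  qed
  then have "det (A ** transpose ?U) = det (transpose ?U ** (\<chi> i j. if i = j then \<mu> i else 0))"
    by simp
  then have "det A * det ?U = det ?U * det ((\<chi> i j. if i = j then \<mu> i else 0) :: real^'a^'a)"
    unfolding det_mul det_transpose .
  moreover have "det ((\<chi> i j. if i = j then \<mu> i else 0) :: real^'a^'a) = (\<Prod>i\<in>UNIV. \<mu> i)"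
    by (subst det_diagonal) auto
  moreover have "det ?U \<noteq> 0"
  proof
    assume "det ?U = 0"
    then have "det (transpose ?U ** ?U) = 0" by (simp add: det_mul)
    then show False by (simp add: orthonormal_family_matrix[OF b])
  qed
  ultimately show ?thesis by simp
qed

lemma spectral_eigenvalue:
  assumes "orthonormal_family b" "A *v b i = c *\<^sub>R b i"
  shows "c = b i \<bullet> (A *v b i)" "b i \<noteq> 0"
proof -
  have "b i \<bullet> b i = 1" using assms(1) by (simp add: orthonormal_family_def)
  then show "c = b i \<bullet> (A *v b i)" "b i \<noteq> 0" using assms(2) by auto
qed

text \<open>The inequality x \<le> exp (x - 1) is multiplied over the eigenvalues, which are
  nonnegative.\<close>

lemma det_le_exp_trace:
  fixes A :: "real^'n^'n"
  assumes "pos_semidef_mat A"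
  shows "det A \<le> exp (trace A - real CARD('n))"
proof -
  obtain b \<mu> where b: "orthonormal_family b" "\<And>i. A *v b i = \<mu> i *\<^sub>R b i"
    using assms spectral_theorem unfolding pos_semidef_mat_def by blast
  have "\<mu> i \<ge> 0" for i
    using assms spectral_eigenvalue(1)[OF b] unfolding pos_semidef_mat_def by simp
  moreover have "\<mu> i \<le> exp (\<mu> i - 1)" for i using exp_ge_add_one_self[of "\<mu> i - 1"] by simp
  ultimately have "det A \<le> (\<Prod>i\<in>UNIV. exp (\<mu> i - 1))"
    unfolding spectral_det[OF b] by (intro prod_mono) auto
  also have "\<dots> = exp (trace A - real CARD('n))"
    by (simp add: exp_sum[symmetric] spectral_trace[OF b] sum_subtractf)
  finally show ?thesis .
qed

lemma pos_def_det_pos: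
  assumes "pos_def_mat A" shows "det A > 0"
proof -
  obtain b \<mu> where b: "orthonormal_family b" "\<And>i. A *v b i = \<mu> i *\<^sub>R b i"
    using assms spectral_theorem unfolding pos_def_mat_def by blast
  have "\<mu> i > 0" for i
    using assms spectral_eigenvalue[OF b] unfolding pos_def_mat_def by simp
  then show ?thesis unfolding spectral_det[OF b] by (intro prod_pos) auto
qed

text \<open>\<open>T\<close> is the inverse square root of \<open>S\<close>, acting by
  \<open>1 / sqrt (\<mu> i)\<close> on an eigenbasis. The clause on fixed vectors ensures later that
  normalising a padded tuple leaves its unit projections alone.\<close>

lemma inverse_square_root_exists:
  assumes "pos_def_mat S"
  obtains T where "sym_mat T" "T ** S ** T = mat 1" "\<And>x. S *v x = x \<Longrightarrow> T *v x = x"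
proof -
  obtain b \<mu> where b: "orthonormal_family b" "\<And>i. S *v b i = \<mu> i *\<^sub>R b i"
    using assms spectral_theorem unfolding pos_def_mat_def by blast
  have pos: "\<mu> i > 0" for i
    using assms spectral_eigenvalue[OF b] unfolding pos_def_mat_def by simp
  define T where "T = (\<Sum>i\<in>UNIV. (1 / sqrt (\<mu> i)) *\<^sub>R rank1 (b i))"
  have Tx: "T *v x = (\<Sum>i\<in>UNIV. (1 / sqrt (\<mu> i)) *\<^sub>R (b i \<bullet> x) *\<^sub>R b i)" for x
    by (simp add: T_def sum_scaleR_matrix_vec rank1_mult_vec)
  have Tb: "T *v b i = (1 / sqrt (\<mu> i)) *\<^sub>R b i" for i
    using b(1) by (simp add: Tx orthonormal_family_def if_distrib[of "\<lambda>x. x *\<^sub>R _"]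
        if_distrib[of "\<lambda>x. _ *\<^sub>R x"] cong: if_cong)
  have "(T ** S ** T) *v b i = b i" for i
    using pos[of i] by (simp add: matrix_vector_mul_assoc[symmetric] Tb b(2) matrix_vector_mult_scaleR)
  then have "T ** S ** T = (\<Sum>i\<in>UNIV. 1 *\<^sub>R rank1 (b i))"
    by (intro spectral_decomposition[OF b(1)]) simp
  also have "\<dots> = mat 1"
    by (rule spectral_decomposition[OF b(1), symmetric]) simp
  finally have 1: "T ** S ** T = mat 1" .
  have 2: "T *v x = x" if "S *v x = x" for x
  proof -
    have "(1 / sqrt (\<mu> i)) * (b i \<bullet> x) = b i \<bullet> x" for i
    proof -
      have "b i \<bullet> (S *v x) = \<mu> i * (b i \<bullet> x)"
        using assms b(2)[of i] by (simp add: pos_def_mat_def sym_mat_inner)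
      with that have "\<mu> i = 1 \<or> b i \<bullet> x = 0" by auto
      then show ?thesis by auto
    qed
    then have "T *v x = (\<Sum>i\<in>UNIV. (b i \<bullet> x) *\<^sub>R b i)" unfolding Tx scaleR_scaleR by simp
    then show ?thesis using orthonormal_expansion[OF b(1)] by simp
  qed
  have "transpose T = T"
    unfolding T_def by (simp add: transpose_def rank1_def vec_eq_iff mult.commute)
  then show ?thesis using that 1 2 by (auto simp: sym_mat_def)
qed

text \<open>An eigenvector has a nonzero component along some \<open>b i\<close>, so every
  eigenvalue occurs among the \<open>\<mu> i\<close>. Hence \<open>Max\<close> and
  \<open>Min\<close> are taken over a finite nonempty set and bound the form expanded in the
  eigenbasis.\<close>

lemma eigenvalues_bounds:
  fixes A :: "real^'n^'n"
  assumes "sym_mat A"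
  shows "lambda_min A * (x \<bullet> x) \<le> x \<bullet> (A *v x)" "x \<bullet> (A *v x) \<le> lambda_max A * (x \<bullet> x)"
    and "lambda_min A \<in> eigenvalues_mat A"
proof -
  obtain b \<mu> where b: "orthonormal_family b" "\<And>i. A *v b i = \<mu> i *\<^sub>R b i"
    using assms spectral_theorem by blast
  have "eigenvalues_mat A = range \<mu>"
  proof (intro equalityI subsetI)
    fix c assume "c \<in> eigenvalues_mat A"
    then obtain v where v: "v \<noteq> 0" "A *v v = c *\<^sub>R v" by (auto simp: eigenvalues_mat_def)
    have "\<exists>i. b i \<bullet> v \<noteq> 0"
    proof (rule ccontr)
      assume "\<not> ?thesis"
      with orthonormal_expansion[OF b(1), of v] v(1) show False by simp
    qed
    then obtain i where i: "b i \<bullet> v \<noteq> 0" by blast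
    have "c * (b i \<bullet> v) = \<mu> i * (b i \<bullet> v)"
      using sym_mat_inner[OF assms, of "b i" v] v(2) b(2)[of i] by simp
    with i show "c \<in> range \<mu>" by auto
  next
    fix c assume "c \<in> range \<mu>"
    then obtain i where "c = \<mu> i" by auto
    with b(2)[of i] spectral_eigenvalue(2)[OF b] show "c \<in> eigenvalues_mat A"
      unfolding eigenvalues_mat_def by blast
  qed
  then have lm: "lambda_min A = Min (range \<mu>)" "lambda_max A = Max (range \<mu>)"
    by (simp_all add: lambda_min_def lambda_max_def)
  then have le: "lambda_min A \<le> \<mu> i" "\<mu> i \<le> lambda_max A" for i by simp_all
  show "lambda_min A \<in> eigenvalues_mat A"
    using Min_in[of "range \<mu>"] \<open>eigenvalues_mat A = range \<mu>\<close> lm(1) by simp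
  have xAx: "x \<bullet> (A *v x) = (\<Sum>i\<in>UNIV. \<mu> i * (b i \<bullet> x)^2)"
    by (subst spectral_decomposition[OF b])
      (simp add: sum_scaleR_matrix_vec rank1_mult_vec inner_sum_right power2_eq_square inner_commute mult_ac)
  have xx: "x \<bullet> x = (\<Sum>i\<in>UNIV. (b i \<bullet> x)^2)"
    by (subst (2) orthonormal_expansion[OF b(1), of x, symmetric])
      (simp add: inner_sum_right power2_eq_square inner_commute mult_ac)
  show "lambda_min A * (x \<bullet> x) \<le> x \<bullet> (A *v x)" "x \<bullet> (A *v x) \<le> lambda_max A * (x \<bullet> x)"
    unfolding xAx xx sum_distrib_left by (intro sum_mono mult_right_mono le zero_le_power2)+
qed

section \<open>Mixed discriminants as sums of determinants\<close>

text \<open>Each variable in \<open>xs\<close> is differentiated exactly once, so the power rule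
  acts factor by factor. An exponent 0 produces the coefficient 0, which makes the truncated
  subtraction harmless.\<close>

lemma mixed_partial_monomials:
  fixes c :: "'f \<Rightarrow> real" and m :: "'f \<Rightarrow> 'n::finite \<Rightarrow> nat"
  assumes "distinct xs"
  shows "mixed_partial xs (\<lambda>t. \<Sum>f\<in>F. c f * (\<Prod>i\<in>UNIV. t i ^ m f i)) =
    (\<lambda>t. \<Sum>f\<in>F. c f * (\<Prod>i\<in>UNIV. if i \<in> set xs then real (m f i) * t i ^ (m f i - 1) else t i ^ m f i))"
  using assms
proof (induction xs)
  case Nil
  show ?case by simp
next
  case (Cons x xs)
  define g where "g f t i = (if i \<in> set xs then real (m f i) * t i ^ (m f i - 1) else t i ^ m f i)"
    for f and t :: "'n \<Rightarrow> real" and i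
  show ?case
  proof
    fix t :: "'n \<Rightarrow> real"
    define a where "a f = (\<Prod>i\<in>UNIV - {x}. g f t i)" for f
    have x: "x \<notin> set xs" using Cons.prems by simp
    have *: "(\<Prod>i\<in>UNIV. g f (t(x := s)) i) = s ^ m f x * a f" for f s
    proof -
      have "(\<Prod>i\<in>UNIV. g f (t(x := s)) i) = g f (t(x := s)) x * (\<Prod>i\<in>UNIV - {x}. g f (t(x := s)) i)"
        by (rule prod.remove) auto
      moreover have "(\<Prod>i\<in>UNIV - {x}. g f (t(x := s)) i) = a f"
        unfolding a_def by (intro prod.cong) (auto simp: g_def)
      ultimately show ?thesis using x by (simp add: g_def)
    qed
    have "((\<lambda>s. \<Sum>f\<in>F. c f * (s ^ m f x * a f)) has_real_derivative
        (\<Sum>f\<in>F. c f * (real (m f x) * t x ^ (m f x - 1) * a f))) (at (t x))"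
      by (auto intro!: derivative_eq_intros sum.cong)
    then have "mixed_partial (x # xs) (\<lambda>t. \<Sum>f\<in>F. c f * (\<Prod>i\<in>UNIV. t i ^ m f i)) t =
        (\<Sum>f\<in>F. c f * (real (m f x) * t x ^ (m f x - 1) * a f))"
      using Cons by (simp add: partial_deriv_def g_def[symmetric] * DERIV_imp_deriv)
    also have "\<dots> = (\<Sum>f\<in>F. c f * (\<Prod>i\<in>UNIV. if i \<in> set (x # xs)
        then real (m f i) * t i ^ (m f i - 1) else t i ^ m f i))"
      by (subst prod.remove[of UNIV x]) (auto simp: a_def g_def intro!: sum.cong prod.cong)
    finally show "mixed_partial (x # xs) (\<lambda>t. \<Sum>f\<in>F. c f * (\<Prod>i\<in>UNIV. t i ^ m f i)) t =
        (\<Sum>f\<in>F. c f * (\<Prod>i\<in>UNIV. if i \<in> set (x # xs) then real (m f i) * t i ^ (m f i - 1) else t i ^ m f i))" .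
  qed
qed

text \<open>At the origin \<open>real (m f i) * 0 ^ (m f i - 1)\<close> is 1 if
  \<open>m f i = 1\<close> and 0 otherwise, so exactly the monomials containing each variable once
  survive, whichever enumeration \<open>SOME\<close> picks. Leaving \<open>c\<close> arbitrary
  allows reuse for transformed tuples.\<close>

lemma mixed_discr_coefficients:
  fixes Q :: "'n::finite \<Rightarrow> real^'n^'n" and c :: "('n \<Rightarrow> 'n) \<Rightarrow> real"
  assumes "\<And>t. det (\<Sum>i\<in>UNIV. t i *\<^sub>R Q i) = (\<Sum>f\<in>UNIV. c f * (\<Prod>r\<in>UNIV. t (f r)))"
  shows "mixed_discr Q = (\<Sum>p | p permutes UNIV. c p)"
proof -
  define m where "m f i = card {r. f r = i}" for f :: "'n \<Rightarrow> 'n" and i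
  define xs where "xs = (SOME xs. distinct xs \<and> set xs = (UNIV :: 'n set))"
  have "distinct xs \<and> set xs = (UNIV :: 'n set)"
  proof -
    obtain ys :: "'n list" where "distinct ys \<and> set ys = UNIV"
      using finite_distinct_list[of "UNIV :: 'n set"] by auto
    then show ?thesis unfolding xs_def by (rule someI)
  qed
  then have xs: "distinct xs" "set xs = UNIV" by auto
  have "(\<Prod>r\<in>UNIV. t (f r)) = (\<Prod>i\<in>UNIV. t i ^ m f i)" for t :: "'n \<Rightarrow> real" and f :: "'n \<Rightarrow> 'n"
  proof -
    have "(\<Prod>r\<in>UNIV. t (f r)) = (\<Prod>i\<in>UNIV. \<Prod>r\<in>{r\<in>UNIV. f r = i}. t (f r))"
      by (rule prod.group[symmetric]) auto
    also have "\<dots> = (\<Prod>i\<in>UNIV. t i ^ m f i)" by (intro prod.cong) (auto simp: m_def)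
    finally show ?thesis .
  qed
  then have "mixed_discr Q = (\<Sum>f\<in>UNIV. c f * (\<Prod>i\<in>UNIV. real (m f i) * 0 ^ (m f i - 1)))"
    unfolding mixed_discr_def xs_def[symmetric] assms
    by (simp add: mixed_partial_monomials[OF xs(1)] xs(2))
  also have "\<dots> = (\<Sum>f\<in>UNIV. if f permutes UNIV then c f else 0)"
  proof (intro sum.cong refl)
    fix f :: "'n \<Rightarrow> 'n"
    show "c f * (\<Prod>i\<in>UNIV. real (m f i) * 0 ^ (m f i - 1)) = (if f permutes UNIV then c f else 0)"
    proof (cases "f permutes UNIV")
      case True
      then have "{r. f r = i} = {inv f i}" for i
        by (auto simp: permutes_inverses permutes_inv_eq)
      then have "m f i = 1" for i by (simp add: m_def)
      then show ?thesis using True by simp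
    next
      case False
      then have "\<not> bij f" by (simp add: permutes_univ bij_iff)
      then have "\<not> surj f" using finite_UNIV_surj_inj[of f] by (auto simp: bij_def)
      then obtain i where "i \<notin> range f" by blast
      then have "{r. f r = i} = {}" by blast
      then have "m f i = 0" by (simp add: m_def)
      then have "(\<Prod>i\<in>UNIV. real (m f i) * 0 ^ (m f i - 1)) = 0"
        by (intro prod_zero) auto
      then show ?thesis using False by simp
    qed
  qed
  also have "\<dots> = (\<Sum>p | p permutes UNIV. c p)"
    by (simp add: sum.If_cases)
  finally show ?thesis .
qed

text \<open>Multilinearity in the rows: \<open>f r\<close> records which summand supplies row
  \<open>r\<close>.\<close>

lemma det_sum_expansion:
  fixes Q :: "'n::finite \<Rightarrow> real^'n^'n"
  shows "det (\<Sum>i\<in>UNIV. t i *\<^sub>R Q i) = (\<Sum>f\<in>UNIV. det (\<chi> r. Q (f r) $ r) * (\<Prod>r\<in>UNIV. t (f r)))"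
proof -
  have "(\<Sum>i\<in>UNIV. t i *\<^sub>R Q i) = (\<chi> r. \<Sum>i\<in>UNIV. t i *s (Q i $ r))"
    by (simp add: vec_eq_iff)
  then have "det (\<Sum>i\<in>UNIV. t i *\<^sub>R Q i) = (\<Sum>f\<in>UNIV. det (\<chi> r. t (f r) *s (Q (f r) $ r)))"
    by (simp add: det_linear_rows_sum)
  also have "\<dots> = (\<Sum>f\<in>UNIV. (\<Prod>r\<in>UNIV. t (f r)) * det (\<chi> r. Q (f r) $ r))"
    by (simp only: det_rows_mul)
  finally show ?thesis by (simp only: mult.commute)
qed

lemma mixed_discr_eq:
  fixes Q :: "'n::finite \<Rightarrow> real^'n^'n"
  shows "mixed_discr Q = (\<Sum>p | p permutes UNIV. det (\<chi> r. Q (p r) $ r))"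
  by (rule mixed_discr_coefficients[OF det_sum_expansion])

lemma sum_congruence:
  "(\<Sum>i\<in>I. t i *\<^sub>R (A ** Q i ** B)) = A ** (\<Sum>i\<in>I. t i *\<^sub>R (Q i :: real^'n^'n)) ** B"
proof (rule matrix_eqI)
  fix x
  show "(\<Sum>i\<in>I. t i *\<^sub>R (A ** Q i ** B)) *v x = (A ** (\<Sum>i\<in>I. t i *\<^sub>R Q i) ** B) *v x"
    by (simp add: matrix_vector_mul_assoc[symmetric] sum_scaleR_matrix_vec
        linear_sum[OF matrix_vector_mul_linear] matrix_vector_mult_scaleR)
qed

text \<open>The determinant polynomial of the transformed tuple is the old one times
  \<open>det A * det B\<close>, so all coefficients scale alike.\<close>

lemma mixed_discr_congruence:
  fixes Q :: "'n::finite \<Rightarrow> real^'n^'n"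
  shows "mixed_discr (\<lambda>i. A ** Q i ** B) = det A * mixed_discr Q * det B"
proof -
  have "det (\<Sum>i\<in>UNIV. t i *\<^sub>R (A ** Q i ** B)) =
      (\<Sum>f\<in>UNIV. (det A * det (\<chi> r. Q (f r) $ r) * det B) * (\<Prod>r\<in>UNIV. t (f r)))" for t
    by (simp add: sum_congruence det_mul det_sum_expansion sum_distrib_left sum_distrib_right mult_ac)
  from mixed_discr_coefficients[OF this] show ?thesis
    by (simp add: mixed_discr_eq sum_distrib_left sum_distrib_right)
qed

lemma mixed_discr_scale:
  fixes Q :: "'n::finite \<Rightarrow> real^'n^'n"
  shows "mixed_discr (\<lambda>i. c i *\<^sub>R Q i) = (\<Prod>i\<in>UNIV. c i) * mixed_discr Q"
proof -
  have "det (\<chi> r. (c (p r) *\<^sub>R Q (p r)) $ r) = (\<Prod>i\<in>UNIV. c i) * det (\<chi> r. Q (p r) $ r)"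
    if "p permutes UNIV" for p
  proof -
    have "(\<chi> r. (c (p r) *\<^sub>R Q (p r)) $ r) = (\<chi> r. c (p r) *s (Q (p r) $ r))"
      by (simp add: vec_eq_iff)
    then have "det (\<chi> r. (c (p r) *\<^sub>R Q (p r)) $ r) = (\<Prod>r\<in>UNIV. c (p r)) * det (\<chi> r. Q (p r) $ r)"
      by (simp only: det_rows_mul)
    also have "(\<Prod>r\<in>UNIV. c (p r)) = (\<Prod>i\<in>UNIV. c i)"
      using prod.permute[OF that, of c] by (simp add: comp_def)
    finally show ?thesis .
  qed
  then show ?thesis by (simp add: mixed_discr_eq sum_distrib_left)
qed

text \<open>For a permutation \<open>p\<close> the matrix \<open>Q j\<close> enters only through row
  \<open>inv p j\<close>, in which the determinant is linear.\<close>

lemma mixed_discr_sum: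
  fixes Q :: "'n::finite \<Rightarrow> real^'n^'n"
  assumes "Q j = (\<Sum>l\<in>L. c l *\<^sub>R M l)" "finite L"
  shows "mixed_discr Q = (\<Sum>l\<in>L. c l * mixed_discr (Q(j := M l)))"
proof -
  have "det (\<chi> r. Q (p r) $ r) = (\<Sum>l\<in>L. c l * det (\<chi> r. (Q(j := M l)) (p r) $ r))"
    if p: "p permutes UNIV" for p
  proof -
    define k where "k = inv p j"
    have k: "p r = j \<longleftrightarrow> r = k" for r
      using p by (auto simp: k_def permutes_inverses permutes_inv_eq)
    have pk: "Q (p k) = Q j" using k[of k] by simp
    have "(\<chi> r. Q (p r) $ r) = (\<chi> r. if r = k then (\<Sum>l\<in>L. c l *s (M l $ k)) else Q (p r) $ r)"
      using k pk assms(1) by (auto simp: vec_eq_iff)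
    then have "det (\<chi> r. Q (p r) $ r) =
        (\<Sum>l\<in>L. det (\<chi> r. if r = k then c l *s (M l $ k) else Q (p r) $ r))"
      by (simp only: det_linear_row_sum[OF assms(2)])
    also have "\<dots> = (\<Sum>l\<in>L. c l * det (\<chi> r. if r = k then M l $ k else Q (p r) $ r))"
      by (simp only: det_row_mul)
    moreover have "(\<chi> r. if r = k then M l $ k else Q (p r) $ r) = (\<chi> r. (Q(j := M l)) (p r) $ r)" for l
      using k by (auto simp: vec_eq_iff)
    ultimately show ?thesis by (simp only:)
  qed
  then have "mixed_discr Q = (\<Sum>p | p permutes UNIV. \<Sum>l\<in>L. c l * det (\<chi> r. (Q(j := M l)) (p r) $ r))"
    by (simp add: mixed_discr_eq)
  also have "\<dots> = (\<Sum>l\<in>L. c l * mixed_discr (Q(j := M l)))"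
    by (subst sum.swap) (simp add: mixed_discr_eq sum_distrib_left)
  finally show ?thesis .
qed

section \<open>Restriction to a coordinate subspace\<close>

definition compress :: "'n set \<Rightarrow> real^'n^'n \<Rightarrow> real^'n^'n" where
  "compress J A = (\<chi> i j. if i \<in> J \<and> j \<in> J then A $ i $ j else 0)"

abbreviation unit_mat :: "'n::finite \<Rightarrow> real^'n^'n" where
  "unit_mat i \<equiv> rank1 (axis i 1)"

lemma unit_mat_nth: "unit_mat i $ r $ s = (if r = i \<and> s = i then 1 else 0)"
  by (simp add: rank1_def axis_def)

lemma unit_mat_row: "unit_mat i $ i = axis i 1"
  by (simp add: vec_eq_iff unit_mat_nth) (simp add: axis_def)

text \<open>A nonzero Leibniz term takes the diagonal entry in every row outside \<open>J\<close>,
  so its permutation fixes those indices and maps \<open>J\<close> to itself. Only the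
  \<open>J\<close> block then matters.\<close>

lemma det_block:
  fixes A B :: "real^'n^'n"
  assumes "\<And>i. i \<notin> J \<Longrightarrow> A $ i = axis i 1" "\<And>i. i \<notin> J \<Longrightarrow> B $ i = axis i 1"
    and "\<And>i j. i \<in> J \<Longrightarrow> j \<in> J \<Longrightarrow> A $ i $ j = B $ i $ j"
  shows "det A = det B"
  unfolding det_def
proof (intro sum.cong refl arg_cong2[where f = "(*)"])
  fix p :: "'n \<Rightarrow> 'n" assume "p \<in> {p. p permutes UNIV}"
  then have p: "inj p" using permutes_inj by auto
  show "(\<Prod>i\<in>UNIV. A $ i $ p i) = (\<Prod>i\<in>UNIV. B $ i $ p i)"
  proof (cases "\<exists>i. i \<notin> J \<and> p i \<noteq> i")
    case True
    then obtain i where i: "i \<notin> J" "p i \<noteq> i" by blast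
    then have "A $ i $ p i = 0" "B $ i $ p i = 0" using assms(1,2) by (auto simp: axis_def)
    then have "(\<Prod>i\<in>UNIV. A $ i $ p i) = 0" "(\<Prod>i\<in>UNIV. B $ i $ p i) = 0"
      by (auto intro!: prod_zero)
    then show ?thesis by (simp only:)
  next
    case False
    have "p i \<in> J" if "i \<in> J" for i
    proof (rule ccontr)
      assume "p i \<notin> J"
      then have "p (p i) = p i" using False by blast
      then have "p i = i" using p by (simp add: inj_eq)
      with \<open>p i \<notin> J\<close> that show False by simp
    qed
    then have "A $ i $ p i = B $ i $ p i" for i
      using assms False by (cases "i \<in> J") auto
    then show ?thesis by (simp only:)
  qed
qed

text \<open>The only nonzero row of \<open>unit_mat i\<close> is row \<open>i\<close>, so a
  permutation contributes only if it fixes every index outside \<open>J\<close>;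
  \<open>det_block\<close> then discards all entries outside the block. This is how a padded tuple
  can stand for one of size \<open>card J\<close>.\<close>

lemma mixed_discr_compress:
  fixes Q R :: "'n::finite \<Rightarrow> real^'n^'n"
  assumes "\<And>i. i \<notin> J \<Longrightarrow> Q i = unit_mat i" "\<And>i. i \<notin> J \<Longrightarrow> R i = unit_mat i"
    and "\<And>i. i \<in> J \<Longrightarrow> R i = compress J (Q i)"
  shows "mixed_discr Q = mixed_discr R"
  unfolding mixed_discr_eq
proof (intro sum.cong refl)
  fix p :: "'n \<Rightarrow> 'n" assume "p \<in> {p. p permutes UNIV}"
  then have p: "p permutes UNIV" by simp
  show "det (\<chi> r. Q (p r) $ r) = det (\<chi> r. R (p r) $ r)"
  proof (cases "\<exists>r. p r \<notin> J \<and> p r \<noteq> r")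
    case True
    then obtain r where r: "p r \<notin> J" "p r \<noteq> r" by blast
    then have z: "Q (p r) $ r = 0" "R (p r) $ r = 0"
      using assms(1)[OF r(1)] assms(2)[OF r(1)] by (auto simp: vec_eq_iff unit_mat_nth)
    have "det (\<chi> r. Q (p r) $ r) = 0" "det (\<chi> r. R (p r) $ r) = 0"
      by (rule det_zero_row(1)[of r], simp add: row_def vec_eq_iff z)+
    then show ?thesis by simp
  next
    case False
    have fix_p: "p i = i" if "i \<notin> J" for i
    proof -
      have "i \<in> range p" using permutes_surj[OF p] by simp
      then obtain r where "p r = i" by blast
      with False that show ?thesis by auto
    qed
    have "p i \<in> J" if "i \<in> J" for i
    proof (rule ccontr)
      assume "p i \<notin> J"
      then have "p i = i" using False by blast
      with \<open>p i \<notin> J\<close> that show False by simp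
    qed
    then show ?thesis using fix_p assms
      by (intro det_block[of J]) (auto simp: unit_mat_row compress_def)
  qed
qed

section \<open>Capacity\<close>

definition coord_space :: "'n set \<Rightarrow> (real^'n) set" where
  "coord_space J = {x. \<forall>i. i \<notin> J \<longrightarrow> x $ i = 0}"

text \<open>Instead of passing to lower dimensions, a \<open>J\<close>-indexed tuple of forms on the coordinate
  space of \<open>J\<close> is padded to a full tuple by the projections \<open>unit_mat i\<close>, \<open>i \<notin> J\<close>.  Comparability
  with a common function \<open>q\<close> replaces \<open>\<alpha>\<close>-conditioning because, unlike the latter, it survives
  scaling, congruence and restriction with the same constant \<open>a\<close>.\<close>

definition conditioned_on :: "real \<Rightarrow> 'n set \<Rightarrow> ('n::finite \<Rightarrow> real^'n^'n) \<Rightarrow> bool" where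
  "conditioned_on a J R \<longleftrightarrow> (\<forall>i. sym_mat (R i)) \<and> (\<forall>i. i \<notin> J \<longrightarrow> R i = unit_mat i) \<and>
    (\<forall>j\<in>J. \<forall>i. i \<notin> J \<longrightarrow> R j *v axis i 1 = 0) \<and>
    (\<exists>q \<tau>. (\<forall>j. \<tau> j > 0) \<and> (\<forall>x\<in>coord_space J. x \<noteq> 0 \<longrightarrow> q x > 0) \<and>
      (\<forall>j\<in>J. \<forall>x\<in>coord_space J. \<tau> j * q x \<le> x \<bullet> (R j *v x) \<and> x \<bullet> (R j *v x) \<le> a * \<tau> j * q x))"

lemma conditioned_onE:
  assumes "conditioned_on a J R"
  obtains \<tau> q where "\<forall>j. \<tau> j > 0"
    "\<forall>x\<in>coord_space J. x \<noteq> 0 \<longrightarrow> q x > 0"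
    "\<forall>j\<in>J. \<forall>x\<in>coord_space J. \<tau> j * q x \<le> x \<bullet> (R j *v x)"
    "\<forall>j\<in>J. \<forall>x\<in>coord_space J. x \<bullet> (R j *v x) \<le> a * \<tau> j * q x"
proof -
  obtain \<tau> q where "\<forall>j. \<tau> j > 0" "\<forall>x\<in>coord_space J. x \<noteq> 0 \<longrightarrow> q x > 0"
    "\<forall>j\<in>J. \<forall>x\<in>coord_space J. \<tau> j * q x \<le> x \<bullet> (R j *v x) \<and> x \<bullet> (R j *v x) \<le> a * \<tau> j * q x"
    using assms unfolding conditioned_on_def by (elim conjE exE)
  then show ?thesis by (intro that[of \<tau> q]) simp_all
qed

lemma matrix_axis_nth: "(A *v axis i 1) $ r = (A :: real^'n^'m) $ r $ i"
  by (simp add: matrix_vector_mult_basis column_def)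

lemma sym_mat_nth: "sym_mat A \<Longrightarrow> A $ r $ s = A $ s $ r"
proof -
  assume "sym_mat A"
  then have "A $ r $ s = transpose A $ r $ s" by (simp only: sym_mat_def)
  then show ?thesis by (simp add: transpose_def)
qed

lemma conditioned_entries:
  assumes "conditioned_on a J R"
  shows "j \<in> J \<Longrightarrow> s \<notin> J \<Longrightarrow> R j $ r $ s = 0" "j \<in> J \<Longrightarrow> r \<notin> J \<Longrightarrow> R j $ r $ s = 0"
    and "i \<notin> J \<Longrightarrow> R i = unit_mat i" "sym_mat (R i)"
proof -
  show *: "j \<in> J \<Longrightarrow> s \<notin> J \<Longrightarrow> R j $ r $ s = 0" for j r s
    using assms matrix_axis_nth[of "R j" s r] by (simp add: conditioned_on_def)
  show "i \<notin> J \<Longrightarrow> R i = unit_mat i" and sym: "\<And>i. sym_mat (R i)"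
    using assms by (simp_all add: conditioned_on_def)
  show "j \<in> J \<Longrightarrow> r \<notin> J \<Longrightarrow> R j $ r $ s = 0"
    using *[of j r s] sym_mat_nth[OF sym, of j r s] by simp
qed

lemma unit_mat_form: "x \<bullet> (unit_mat i *v x) = (x $ i)\<^sup>2"
  by (simp add: rank1_mult_vec inner_axis inner_axis' power2_eq_square)

text \<open>\<open>R j\<close> ignores the coordinates outside \<open>J\<close>, so its form at
  \<open>x\<close> equals its form at the truncation \<open>y\<close>, where the comparison with
  \<open>q\<close> applies.\<close>

lemma conditioned_form_pos:
  assumes c: "conditioned_on a J R" and j: "j \<in> J"
  shows "x \<bullet> (R j *v x) \<ge> 0" "i \<in> J \<Longrightarrow> x $ i \<noteq> 0 \<Longrightarrow> x \<bullet> (R j *v x) > 0"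
proof -
  define y where "y = (\<chi> i. if i \<in> J then x $ i else 0)"
  have yW: "y \<in> coord_space J" by (simp add: y_def coord_space_def)
  have 1: "R j *v x = R j *v y"
    using conditioned_entries(1)[OF c j]
    by (auto simp: vec_eq_iff matrix_vector_mult_def y_def intro!: sum.cong)
  have "(R j *v y) $ i = 0" if "i \<notin> J" for i
    using conditioned_entries(2)[OF c j that] by (simp add: matrix_vector_mult_def)
  then have 2: "x \<bullet> (R j *v y) = y \<bullet> (R j *v y)"
    by (auto simp: inner_vec_def y_def intro!: sum.cong)
  obtain \<tau> q where \<tau> [rule_format]: "\<forall>j. \<tau> j > 0"
    and q [rule_format]: "\<forall>x\<in>coord_space J. x \<noteq> 0 \<longrightarrow> q x > 0"
    and low [rule_format]: "\<forall>j\<in>J. \<forall>x\<in>coord_space J. \<tau> j * q x \<le> x \<bullet> (R j *v x)"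
    and up [rule_format]: "\<forall>j\<in>J. \<forall>x\<in>coord_space J. x \<bullet> (R j *v x) \<le> a * \<tau> j * q x"
    by (rule conditioned_onE[OF c]) (rule that)
  have pos: "x \<bullet> (R j *v x) > 0" if "y \<noteq> 0"
  proof -
    have "0 < \<tau> j * q y" by (intro mult_pos_pos \<tau> q yW that)
    also have "\<dots> \<le> y \<bullet> (R j *v y)" by (rule low[OF j yW])
    finally show ?thesis using 1 2 by simp
  qed
  then show "x \<bullet> (R j *v x) \<ge> 0" using 1 2 by (cases "y = 0") auto
  show "x \<bullet> (R j *v x) > 0" if "i \<in> J" "x $ i \<noteq> 0"
  proof (rule pos)
    have "y $ i \<noteq> 0" using that by (simp add: y_def)
    then show "y \<noteq> 0" by auto
  qed
qed

lemma conditioned_semidef: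
  assumes c: "conditioned_on a J R"
  shows "pos_semidef_mat (R i)"
proof (cases "i \<in> J")
  case True
  show ?thesis
    unfolding pos_semidef_mat_def using conditioned_form_pos(1)[OF c True] conditioned_entries(4)[OF c] by blast
next
  case False
  have "x \<bullet> (R i *v x) \<ge> 0" for x
    by (simp only: conditioned_entries(3)[OF c False] unit_mat_form zero_le_power2)
  then show ?thesis
    unfolding pos_semidef_mat_def using conditioned_entries(4)[OF c] by blast
qed

lemma sum_form: "x \<bullet> ((\<Sum>i\<in>I. t i *\<^sub>R (R i :: real^'n^'n)) *v x) = (\<Sum>i\<in>I. t i * (x \<bullet> (R i *v x)))"
  by (simp add: sum_scaleR_matrix_vec inner_sum_right)

lemma transpose_sum: "transpose (\<Sum>i\<in>I. t i *\<^sub>R (R i :: real^'n^'n)) = (\<Sum>i\<in>I. t i *\<^sub>R transpose (R i))"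
  by (simp add: vec_eq_iff transpose_def)

lemma pos_semidef_sum:
  assumes "\<And>i. i \<in> I \<Longrightarrow> pos_semidef_mat (R i)" "\<And>i. i \<in> I \<Longrightarrow> t i \<ge> 0"
  shows "pos_semidef_mat (\<Sum>i\<in>I. t i *\<^sub>R R i)"
  unfolding pos_semidef_mat_def
proof
  show "sym_mat (\<Sum>i\<in>I. t i *\<^sub>R R i)"
    using assms(1) by (simp add: sym_mat_def transpose_sum pos_semidef_mat_def)
  show "\<forall>x. x \<bullet> ((\<Sum>i\<in>I. t i *\<^sub>R R i) *v x) \<ge> 0"
    unfolding sum_form using assms by (auto intro!: sum_nonneg mult_nonneg_nonneg simp: pos_semidef_mat_def)
qed

text \<open>One positive weight in \<open>J\<close> handles all vectors with a nonzero coordinate in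
  \<open>J\<close>, and the padding handles the others. Allowing zero weights elsewhere in
  \<open>J\<close> is what keeps determinants positive on the boundary of the simplex used for the
  capacity.\<close>

lemma conditioned_pos_def:
  fixes R :: "'n::finite \<Rightarrow> real^'n^'n"
  assumes c: "conditioned_on a J R" and t: "\<And>i. t i \<ge> 0" "\<And>i. i \<notin> J \<Longrightarrow> t i = 1"
    and j: "j \<in> J" "t j > 0"
  shows "pos_def_mat (\<Sum>i\<in>UNIV. t i *\<^sub>R R i)"
  unfolding pos_def_mat_def
proof (intro conjI allI impI)
  have psd: "pos_semidef_mat (R i)" for i by (rule conditioned_semidef[OF c])
  then show "sym_mat (\<Sum>i\<in>UNIV. t i *\<^sub>R R i)"
    using pos_semidef_sum[of UNIV R t] t(1) by (auto simp: pos_semidef_mat_def)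
  fix x :: "real^'n" assume "x \<noteq> 0"
  then obtain i where i: "x $ i \<noteq> 0" by (auto simp: vec_eq_iff)
  have nn: "t i * (x \<bullet> (R i *v x)) \<ge> 0" for i
    using t(1) psd by (simp add: pos_semidef_mat_def)
  have "\<exists>k. t k * (x \<bullet> (R k *v x)) > 0"
  proof (cases "i \<in> J")
    case True
    then show ?thesis using conditioned_form_pos(2)[OF c j(1) True i] j(2) by (intro exI[of _ j]) simp
  next
    case False
    then show ?thesis using i t(2)[OF False] conditioned_entries(3)[OF c False]
      by (intro exI[of _ i]) (simp add: unit_mat_form)
  qed
  then obtain k where "t k * (x \<bullet> (R k *v x)) > 0" by blast
  then show "x \<bullet> ((\<Sum>i\<in>UNIV. t i *\<^sub>R R i) *v x) > 0"
    unfolding sum_form by (intro sum_pos2[of UNIV k]) (auto simp: nn)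
qed

text \<open>Matrices indexed by \<open>J\<close> occupy the rows in \<open>J\<close> and the padding
  occupies the rest, so scaling the weights in \<open>J\<close> just scales \<open>card J\<close>
  rows.\<close>

lemma conditioned_det_homogeneous:
  fixes R :: "'n::finite \<Rightarrow> real^'n^'n"
  assumes c: "conditioned_on a J R" and s: "\<And>i. i \<in> J \<Longrightarrow> s i = \<sigma> * s' i" "\<And>i. i \<notin> J \<Longrightarrow> s i = s' i"
  shows "det (\<Sum>i\<in>UNIV. s i *\<^sub>R R i) = \<sigma> ^ card J * det (\<Sum>i\<in>UNIV. s' i *\<^sub>R R i)"
    and "(\<Prod>i\<in>UNIV. s i) = \<sigma> ^ card J * (\<Prod>i\<in>UNIV. s' i)"
proof -
  let ?d = "\<lambda>r. if r \<in> J then \<sigma> else 1"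
  have "s i * R i $ r $ k = ?d r * (s' i * R i $ r $ k)" for i r k
    using s conditioned_entries(2,3)[OF c] by (cases "i \<in> J"; cases "r \<in> J") (auto simp: unit_mat_nth)
  then have "(\<Sum>i\<in>UNIV. s i * R i $ r $ k) = ?d r * (\<Sum>i\<in>UNIV. s' i * R i $ r $ k)" for r k
    unfolding sum_distrib_left by (intro sum.cong refl)
  then have eq: "(\<Sum>i\<in>UNIV. s i *\<^sub>R R i) = (\<chi> r. ?d r *s (\<Sum>i\<in>UNIV. s' i *\<^sub>R R i) $ r)"
    by (simp add: vec_eq_iff del: if_split)
  have d: "(\<Prod>r\<in>UNIV. ?d r) = \<sigma> ^ card J"
    by (simp add: prod.If_cases)
  show "det (\<Sum>i\<in>UNIV. s i *\<^sub>R R i) = \<sigma> ^ card J * det (\<Sum>i\<in>UNIV. s' i *\<^sub>R R i)"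
    unfolding eq det_rows_mul d by (simp only: vec_lambda_eta)
  have "(\<Prod>i\<in>UNIV. s i) = (\<Prod>i\<in>UNIV. ?d i * s' i)"
    using s by (intro prod.cong) auto
  then show "(\<Prod>i\<in>UNIV. s i) = \<sigma> ^ card J * (\<Prod>i\<in>UNIV. s' i)"
    by (simp add: prod.distrib d)
qed

lemma continuous_on_det:
  assumes "\<And>i j. continuous_on S (\<lambda>x. f x $ i $ j)"
  shows "continuous_on S (\<lambda>x. det (f x :: real^'n^'n))"
  unfolding det_def
  by (rule continuous_on_sum, rule continuous_on_mult, rule continuous_on_const,
      rule continuous_on_prod, rule assms)

text \<open>On the compact simplex \<open>K\<close> the denominator of \<open>g\<close> stays
  positive even on the boundary, so \<open>g\<close> has a maximiser; as \<open>g\<close> vanishes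
  wherever some weight is zero, its weights are all positive.\<close>

lemma capacity_attained:
  fixes R :: "'n::finite \<Rightarrow> real^'n^'n"
  assumes c: "conditioned_on a J R" and "J \<noteq> {}"
  obtains t where "\<And>i. t i > 0" "\<And>i. i \<notin> J \<Longrightarrow> t i = 1"
    "\<And>s. (\<And>i. s i > 0) \<Longrightarrow> (\<And>i. i \<notin> J \<Longrightarrow> s i = 1) \<Longrightarrow>
      det (\<Sum>i\<in>UNIV. t i *\<^sub>R R i) * (\<Prod>i\<in>UNIV. s i) \<le> det (\<Sum>i\<in>UNIV. s i *\<^sub>R R i) * (\<Prod>i\<in>UNIV. t i)"
proof -
  define K where "K = {t :: real^'n. (\<forall>i. 0 \<le> t $ i \<and> t $ i \<le> 1) \<and> (\<forall>i. i \<notin> J \<longrightarrow> t $ i = 1) \<and> (\<Sum>j\<in>J. t $ j) = 1}"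
  define M where "M t = (\<Sum>i\<in>UNIV. t $ i *\<^sub>R R i)" for t :: "real^'n"
  \<comment> \<open>\<open>g\<close> is homogeneous of degree \<open>0\<close>, so it suffices to maximise it on a simplex.\<close>
  define g where "g t = (\<Prod>i\<in>UNIV. t $ i) / det (M t)" for t
  have "K = cbox 0 1 \<inter> (\<Inter>i\<in>-J. {t. t $ i = 1}) \<inter> {t. (\<Sum>j\<in>J. t $ j) = 1}"
    unfolding K_def set_eq_iff by (simp add: mem_box_cart) blast
  moreover have "closed {t :: real^'n. t $ i = 1}" for i
    by (intro closed_Collect_eq continuous_on_component continuous_on_id continuous_on_const)
  moreover have "closed {t :: real^'n. (\<Sum>j\<in>J. t $ j) = 1}"
    by (intro closed_Collect_eq continuous_on_sum continuous_on_component continuous_on_id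
        continuous_on_const)
  ultimately have "compact K"
    by (simp add: compact_Int_closed closed_INT)
  have det_pos: "det (M t) > 0" if t: "t \<in> K" for t
  proof -
    have "\<exists>j\<in>J. t $ j > 0"
    proof (rule ccontr)
      assume "\<not> ?thesis"
      then have "(\<Sum>j\<in>J. t $ j) \<le> 0" by (intro sum_nonpos) (auto simp: not_less)
      with t show False by (simp add: K_def)
    qed
    then obtain j where j: "j \<in> J" "t $ j > 0" by blast
    show ?thesis unfolding M_def
      by (rule pos_def_det_pos, rule conditioned_pos_def[where t = "\<lambda>i. t $ i", OF c _ _ j]) (use t in \<open>auto simp: K_def\<close>)
  qed
  have contM: "continuous_on K (\<lambda>t. M t $ i $ j)" for i j
    unfolding M_def sum_component vector_scaleR_component
    by (intro continuous_on_sum continuous_on_scaleR continuous_on_const continuous_on_component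
        continuous_on_id)
  have "continuous_on K (\<lambda>t. \<Prod>i\<in>UNIV. t $ i)"
    by (intro continuous_on_prod continuous_on_component continuous_on_id)
  then have "continuous_on K g"
    unfolding g_def using less_imp_neq[OF det_pos]
    by (intro continuous_on_divide continuous_on_det contM) auto
  \<comment> \<open>The barycentre of the simplex has \<open>g u > 0\<close>, so the maximum of
    \<open>g\<close> is positive.\<close>
  define u where "u = (\<chi> i. if i \<in> J then 1 / real (card J) else 1)"
  have J: "card J > 0" using \<open>J \<noteq> {}\<close> by (simp add: card_gt_0_iff)
  have "(\<Sum>j\<in>J. u $ j) = (\<Sum>j\<in>J. 1 / real (card J))" by (intro sum.cong) (auto simp: u_def)
  with J \<open>J \<noteq> {}\<close> have uK: "u \<in> K" by (simp add: K_def u_def)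
  obtain t where t: "t \<in> K" and max: "\<And>s. s \<in> K \<Longrightarrow> g s \<le> g t"
    using continuous_attains_sup[OF \<open>compact K\<close> _ \<open>continuous_on K g\<close>] uK by blast
  have "0 < g u" unfolding g_def using J det_pos[OF uK]
    by (intro divide_pos_pos prod_pos) (auto simp: u_def)
  also have "\<dots> \<le> g t" by (rule max[OF uK])
  finally have "(\<Prod>i\<in>UNIV. t $ i) > 0"
    unfolding g_def using det_pos[OF t] by (simp only: zero_less_divide_iff) linarith
  then have "(\<Prod>i\<in>UNIV. t $ i) \<noteq> 0" by linarith
  then have "t $ i \<noteq> 0" for i by simp
  then have tpos: "t $ i > 0" for i using t unfolding K_def by (simp add: order_less_le)
  show ?thesis
  proof (rule that[of "\<lambda>i. t $ i"])
    show "t $ i > 0" for i by (rule tpos)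
    show "t $ i = 1" if "i \<notin> J" for i using t that by (auto simp: K_def)
    fix s :: "'n \<Rightarrow> real" assume s: "\<And>i. s i > 0" "\<And>i. i \<notin> J \<Longrightarrow> s i = 1"
    define \<sigma> where "\<sigma> = (\<Sum>j\<in>J. s j)"
    have \<sigma>: "\<sigma> > 0" unfolding \<sigma>_def using s \<open>J \<noteq> {}\<close> by (intro sum_pos) auto
    \<comment> \<open>Rescaling the weights in \<open>J\<close> to sum 1 brings \<open>s\<close>
      into \<open>K\<close>; homogeneity carries the inequality back to \<open>s\<close>.\<close>
    define s' where "s' = (\<chi> i. if i \<in> J then s i / \<sigma> else 1)"
    have le: "s i \<le> \<sigma>" if "i \<in> J" for i
      unfolding \<sigma>_def using s that by (intro member_le_sum) (auto simp: less_imp_le)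
    have "(\<Sum>j\<in>J. s' $ j) = (\<Sum>j\<in>J. s j / \<sigma>)" by (intro sum.cong) (auto simp: s'_def)
    also have "\<dots> = 1" using \<sigma> by (simp only: sum_divide_distrib[symmetric] \<sigma>_def[symmetric]) simp
    finally have "s' \<in> K"
      using s(1)[THEN less_imp_le] \<sigma> le by (simp add: K_def s'_def)
    from max[OF this] have "g s' \<le> g t" .
    then have *: "det (M t) * (\<Prod>i\<in>UNIV. s' $ i) \<le> det (M s') * (\<Prod>i\<in>UNIV. t $ i)"
      using det_pos[OF t] det_pos[OF \<open>s' \<in> K\<close>] by (simp add: g_def field_simps)
    have h: "det (\<Sum>i\<in>UNIV. s i *\<^sub>R R i) = \<sigma> ^ card J * det (M s')"
      "(\<Prod>i\<in>UNIV. s i) = \<sigma> ^ card J * (\<Prod>i\<in>UNIV. s' $ i)"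
      using conditioned_det_homogeneous[OF c, of s \<sigma> "\<lambda>i. s' $ i"] s \<sigma> by (simp_all add: s'_def M_def)
    have "\<sigma> ^ card J * (det (M t) * (\<Prod>i\<in>UNIV. s' $ i)) \<le> \<sigma> ^ card J * (det (M s') * (\<Prod>i\<in>UNIV. t $ i))"
      using * \<sigma> by (intro mult_left_mono) auto
    then show "det (\<Sum>i\<in>UNIV. t $ i *\<^sub>R R i) * (\<Prod>i\<in>UNIV. s i) \<le> det (\<Sum>i\<in>UNIV. s i *\<^sub>R R i) * (\<Prod>i\<in>UNIV. t $ i)"
      unfolding h M_def[symmetric] by (simp add: mult_ac)
  qed
qed

text \<open>For small \<open>\<epsilon>\<close> of either sign, \<open>1 + \<epsilon> \<le> det (mat 1 + \<epsilon> *\<^sub>R P j) \<le> exp (\<epsilon> * trace (P j))\<close> with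
  equality at \<open>0\<close>, so both sides have the same derivative there.\<close>

lemma trace_eq_1_if_capacity:
  fixes P :: "'n::finite \<Rightarrow> real^'n^'n"
  assumes psd: "\<And>i. pos_semidef_mat (P i)" and sum: "(\<Sum>i\<in>UNIV. P i) = mat 1"
    and cap: "\<And>t. (\<And>i. t i > 0) \<Longrightarrow> (\<And>i. i \<noteq> j \<Longrightarrow> t i = 1) \<Longrightarrow> (\<Prod>i\<in>UNIV. t i) \<le> det (\<Sum>i\<in>UNIV. t i *\<^sub>R P i)"
  shows "trace (P j) = 1"
proof -
  define h where "h \<epsilon> = exp (\<epsilon> * trace (P j)) - (1 + \<epsilon>)" for \<epsilon> :: real
  have h: "h \<epsilon> \<ge> 0" if "\<bar>\<epsilon>\<bar> < 1" for \<epsilon>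
  proof -
    define t where "t = (\<lambda>i. if i = j then 1 + \<epsilon> else 1)"
    have "(\<Sum>i\<in>UNIV. t i *\<^sub>R P i) = (\<Sum>i\<in>UNIV. P i + (if i = j then \<epsilon> *\<^sub>R P i else 0))"
      by (intro sum.cong) (auto simp: t_def algebra_simps)
    also have "\<dots> = mat 1 + \<epsilon> *\<^sub>R P j" by (simp add: sum.distrib sum)
    finally have S: "(\<Sum>i\<in>UNIV. t i *\<^sub>R P i) = mat 1 + \<epsilon> *\<^sub>R P j" .
    have tp: "t i > 0" for i using that by (auto simp: t_def)
    have "1 + \<epsilon> = (\<Prod>i\<in>UNIV. t i)"
      by (simp add: t_def)
    also have "\<dots> \<le> det (\<Sum>i\<in>UNIV. t i *\<^sub>R P i)" by (rule cap[OF tp]) (simp add: t_def)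
    also have "\<dots> \<le> exp (trace (\<Sum>i\<in>UNIV. t i *\<^sub>R P i) - real CARD('n))"
      by (intro det_le_exp_trace pos_semidef_sum psd less_imp_le tp)
    also have "trace (\<Sum>i\<in>UNIV. t i *\<^sub>R P i) = real CARD('n) + \<epsilon> * trace (P j)"
      unfolding S by (simp add: linear_add[OF linear_trace] linear_cmul[OF linear_trace] trace_I)
    finally show ?thesis by (simp add: h_def)
  qed
  have "(h has_real_derivative (trace (P j) - 1)) (at 0)"
    unfolding h_def by (auto intro!: derivative_eq_intros)
  moreover have "\<forall>y. \<bar>0 - y\<bar> < 1 \<longrightarrow> h 0 \<le> h y" using h by (simp add: h_def)
  ultimately have "trace (P j) - 1 = 0" by (rule DERIV_local_min[OF _ zero_less_one])
  then show ?thesis by simp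
qed

section \<open>Doubly stochastic tuples\<close>

lemma sum_form_mat_1:
  assumes "(\<Sum>i\<in>UNIV. (P i :: real^'n^'n)) = mat 1"
  shows "(\<Sum>i\<in>(UNIV :: 'n::finite set). x \<bullet> (P i *v x)) = x \<bullet> x"
  using sum_form[of x "\<lambda>_. 1" P UNIV] assms by simp

lemma sum_form_split:
  fixes P :: "'n::finite \<Rightarrow> real^'n^'n"
  assumes c: "conditioned_on a J P"
  shows "(\<Sum>i\<in>UNIV. x \<bullet> (P i *v x)) = (\<Sum>i\<in>J. x \<bullet> (P i *v x)) + (\<Sum>i\<in>-J. (x $ i)\<^sup>2)"
proof -
  have "(\<Sum>i\<in>UNIV. x \<bullet> (P i *v x)) = (\<Sum>i\<in>J. x \<bullet> (P i *v x)) + (\<Sum>i\<in>-J. x \<bullet> (P i *v x))"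
    using sum.subset_diff[of J UNIV "\<lambda>i. x \<bullet> (P i *v x)"] by (simp add: Compl_eq_Diff_UNIV add.commute)
  also have "(\<Sum>i\<in>-J. x \<bullet> (P i *v x)) = (\<Sum>i\<in>-J. (x $ i)\<^sup>2)"
    by (intro sum.cong refl) (simp add: conditioned_entries(3)[OF c] unit_mat_form)
  finally show ?thesis .
qed

text \<open>On \<open>coord_space J\<close> the forms add up to the identity, so summing the
  comparisons with \<open>q\<close> places \<open>x \<bullet> x\<close> between
  \<open>S * q x\<close> and \<open>a * S * q x\<close>. The upper estimate at the axes and the
  trace condition give \<open>\<tau> j \<le> a * S / real (card J)\<close>. One factor
  \<open>a\<close> thus comes from \<open>\<tau> j\<close>, the other from the upper bound on
  \<open>P j\<close>.\<close>

lemma doubly_stochastic_form_le: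
  fixes P :: "'n::finite \<Rightarrow> real^'n^'n"
  assumes c: "conditioned_on a J P" and sum: "(\<Sum>i\<in>UNIV. P i) = mat 1"
    and tr: "trace (P j) = 1" and j: "j \<in> J" and x: "x \<in> coord_space J" and a: "a \<ge> 0"
  shows "x \<bullet> (P j *v x) \<le> a\<^sup>2 / real (card J) * (x \<bullet> x)"
proof -
  obtain \<tau> q where \<tau> [rule_format]: "\<forall>j. \<tau> j > 0"
    and q [rule_format]: "\<forall>x\<in>coord_space J. x \<noteq> 0 \<longrightarrow> q x > 0"
    and low [rule_format]: "\<forall>j\<in>J. \<forall>x\<in>coord_space J. \<tau> j * q x \<le> x \<bullet> (P j *v x)"
    and up [rule_format]: "\<forall>j\<in>J. \<forall>x\<in>coord_space J. x \<bullet> (P j *v x) \<le> a * \<tau> j * q x"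
    by (rule conditioned_onE[OF c]) (rule that)
  define S where "S = (\<Sum>j\<in>J. \<tau> j)"
  have S: "S > 0" unfolding S_def using \<tau> j by (intro sum_pos) auto
  have k: "real (card J) > 0" using j by (auto simp: card_gt_0_iff)
  have split: "(\<Sum>i\<in>J. y \<bullet> (P i *v y)) = y \<bullet> y" if "y \<in> coord_space J" for y
  proof -
    have "(\<Sum>i\<in>-J. (y $ i)\<^sup>2) = 0" using that by (intro sum.neutral) (auto simp: coord_space_def)
    then show ?thesis using sum_form_split[OF c, of y] sum_form_mat_1[OF sum, of y] by linarith
  qed
  have "(\<Sum>i\<in>J. \<tau> i * q x) \<le> (\<Sum>i\<in>J. x \<bullet> (P i *v x))" by (intro sum_mono low x)
  then have Sq: "S * q x \<le> x \<bullet> x" using split[OF x] by (simp add: S_def sum_distrib_right)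
  have "1 = (\<Sum>i\<in>UNIV. P j $ i $ i)" using tr by (simp add: trace_def)
  also have "\<dots> = (\<Sum>i\<in>J. P j $ i $ i)"
    using conditioned_entries(1)[OF c j] by (intro sum.mono_neutral_right) auto
  finally have t1: "1 = (\<Sum>i\<in>J. P j $ i $ i)" .
  have "\<tau> j \<le> a * S * (P j $ i $ i)" if i: "i \<in> J" for i
  proof -
    have ax: "axis i 1 \<in> coord_space J" using i by (auto simp: coord_space_def axis_def)
    have "1 \<le> a * S * q (axis i 1)"
    proof -
      have "(\<Sum>k\<in>J. axis i 1 \<bullet> (P k *v axis i 1)) \<le> (\<Sum>k\<in>J. a * \<tau> k * q (axis i 1))"
        by (intro sum_mono up ax)
      then show ?thesis using split[OF ax]
        by (simp add: S_def sum_distrib_left sum_distrib_right inner_axis_axis)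
    qed
    then have "\<tau> j * 1 \<le> \<tau> j * (a * S * q (axis i 1))"
      using \<tau>[of j] by (intro mult_left_mono) auto
    also have "\<dots> = a * S * (\<tau> j * q (axis i 1))" by (simp add: mult_ac)
    also have "\<dots> \<le> a * S * (P j $ i $ i)"
      using low[OF j ax] a S by (intro mult_left_mono) (auto simp: inner_axis' matrix_axis_nth)
    finally show ?thesis by simp
  qed
  then have "(\<Sum>i\<in>J. \<tau> j) \<le> (\<Sum>i\<in>J. a * S * (P j $ i $ i))" by (intro sum_mono)
  also have "\<dots> = a * S" using t1 by (simp add: sum_distrib_left[symmetric])
  finally have \<tau>j: "\<tau> j \<le> a * S / real (card J)" using k by (simp add: field_simps)
  show ?thesis
  proof (cases "x = 0")
    case False
    then have qx: "q x \<ge> 0" using q[OF x] by simp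
    have "x \<bullet> (P j *v x) \<le> a * \<tau> j * q x" by (rule up[OF j x])
    also have "\<dots> \<le> a * (a * S / real (card J)) * q x"
      using \<tau>j a qx by (intro mult_right_mono mult_left_mono)
    also have "\<dots> = a\<^sup>2 / real (card J) * (S * q x)" by (simp add: power2_eq_square)
    also have "\<dots> \<le> a\<^sup>2 / real (card J) * (x \<bullet> x)" using Sq by (intro mult_left_mono) auto
    finally show ?thesis .
  qed simp
qed

section \<open>Stability of conditioning under congruence and restriction\<close>

text \<open>The new comparison function is \<open>q\<close> composed with \<open>T\<close>, and
  \<open>\<tau> j\<close> absorbs the weight \<open>t j\<close>, so \<open>a\<close> is unchanged. A
  symmetric \<open>T\<close> that fixes the padding axes preserves \<open>coord_space J\<close>; the
  left inverse \<open>U\<close> makes \<open>T\<close> injective, which keeps the new function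
  positive.\<close>

lemma conditioned_congruence:
  fixes R :: "'n::finite \<Rightarrow> real^'n^'n"
  assumes c: "conditioned_on a J R" and T: "sym_mat T" "U ** T = mat 1"
    and fix_T: "\<And>i. i \<notin> J \<Longrightarrow> T *v axis i 1 = axis i 1"
    and t: "\<And>i. t i > 0" "\<And>i. i \<notin> J \<Longrightarrow> t i = 1"
  shows "conditioned_on a J (\<lambda>i. t i *\<^sub>R (T ** R i ** T))"
proof -
  have TT: "transpose T = T" using T(1) by (simp add: sym_mat_def)
  have form: "x \<bullet> ((t i *\<^sub>R (T ** R i ** T)) *v x) = t i * ((T *v x) \<bullet> (R i *v (T *v x)))" for x i
    by (simp add: scaleR_matrix_vector_assoc[symmetric] matrix_vector_mul_assoc[symmetric] sym_mat_inner[OF T(1)])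
  have W: "T *v x \<in> coord_space J" if "x \<in> coord_space J" for x
  proof -
    have "(T *v x) $ i = 0" if "i \<notin> J" for i
    proof -
      have "(T *v x) $ i = x \<bullet> (T *v axis i 1)"
        unfolding sym_mat_inner[OF T(1)] by (simp add: inner_axis)
      also have "\<dots> = x $ i" by (simp add: fix_T[OF that] inner_axis)
      finally show ?thesis using \<open>x \<in> _\<close> that by (simp add: coord_space_def)
    qed
    then show ?thesis by (simp add: coord_space_def)
  qed
  have nz: "T *v x \<noteq> 0" if "x \<noteq> 0" for x
  proof
    assume "T *v x = 0"
    then have "U *v (T *v x) = 0" by simp
    then show False using that by (simp add: matrix_vector_mul_assoc T(2))
  qed
  obtain \<tau> q where \<tau> [rule_format]: "\<forall>j. \<tau> j > 0"
    and q [rule_format]: "\<forall>x\<in>coord_space J. x \<noteq> 0 \<longrightarrow> q x > 0"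
    and low [rule_format]: "\<forall>j\<in>J. \<forall>x\<in>coord_space J. \<tau> j * q x \<le> x \<bullet> (R j *v x)"
    and up [rule_format]: "\<forall>j\<in>J. \<forall>x\<in>coord_space J. x \<bullet> (R j *v x) \<le> a * \<tau> j * q x"
    by (rule conditioned_onE[OF c]) (rule that)
  show ?thesis
    unfolding conditioned_on_def
  proof (intro conjI allI impI ballI exI[of _ "\<lambda>x. q (T *v x)"] exI[of _ "\<lambda>j. t j * \<tau> j"])
    fix i
    show "sym_mat (t i *\<^sub>R (T ** R i ** T))"
      using conditioned_entries(4)[OF c, of i] TT
      by (simp add: sym_mat_def transpose_scalar matrix_transpose_mul matrix_mul_assoc)
    show "t i *\<^sub>R (T ** R i ** T) = unit_mat i" if "i \<notin> J"
      using rank1_congruence[of T "axis i 1"] fix_T[OF that] t(2)[OF that] TT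
      by (simp add: conditioned_entries(3)[OF c that])
    show "t j *\<^sub>R (T ** R j ** T) *v axis i 1 = 0" if "j \<in> J" "i \<notin> J" for j
      using that c by (simp add: scaleR_matrix_vector_assoc[symmetric] matrix_vector_mul_assoc[symmetric]
          fix_T conditioned_on_def)
    show "t i * \<tau> i > 0" using t(1) \<tau> by simp
  next
    fix x :: "real^'n" assume x: "x \<in> coord_space J"
    show "q (T *v x) > 0" if "x \<noteq> 0" using q W x nz that by blast
    fix j assume j: "j \<in> J"
    show "t j * \<tau> j * q (T *v x) \<le> x \<bullet> (t j *\<^sub>R (T ** R j ** T) *v x)"
      using mult_left_mono[OF low[OF j W[OF x]], of "t j"] t(1)[of j] by (simp add: form mult_ac)
    show "x \<bullet> (t j *\<^sub>R (T ** R j ** T) *v x) \<le> a * (t j * \<tau> j) * q (T *v x)"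
      using mult_left_mono[OF up[OF j W[OF x]], of "t j"] t(1)[of j] by (simp add: form mult_ac)
  qed
qed

lemma compress_form:
  assumes "x \<in> coord_space J"
  shows "x \<bullet> (compress J A *v x) = x \<bullet> (A *v x)"
proof -
  have 1: "(compress J A *v x) $ i = (A *v x) $ i" if "i \<in> J" for i
    using assms that by (auto simp: compress_def matrix_vector_mult_def coord_space_def intro!: sum.cong)
  have "x $ i * (compress J A *v x) $ i = x $ i * (A *v x) $ i" for i
    using 1[of i] assms by (cases "i \<in> J") (auto simp: coord_space_def)
  then show ?thesis unfolding inner_vec_def inner_real_def by (intro sum.cong refl)
qed

text \<open>The old \<open>q\<close> and \<open>\<tau>\<close> still serve, because compression does
  not change the forms on the smaller space \<open>coord_space I\<close>.\<close>

lemma conditioned_restrict: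
  fixes R :: "'n::finite \<Rightarrow> real^'n^'n"
  assumes c: "conditioned_on a J R" and "I \<subseteq> J"
  shows "conditioned_on a I (\<lambda>i. if i \<in> I then compress I (R i) else unit_mat i)"
proof -
  obtain \<tau> q where \<tau> [rule_format]: "\<forall>j. \<tau> j > 0"
    and q [rule_format]: "\<forall>x\<in>coord_space J. x \<noteq> 0 \<longrightarrow> q x > 0"
    and low [rule_format]: "\<forall>j\<in>J. \<forall>x\<in>coord_space J. \<tau> j * q x \<le> x \<bullet> (R j *v x)"
    and up [rule_format]: "\<forall>j\<in>J. \<forall>x\<in>coord_space J. x \<bullet> (R j *v x) \<le> a * \<tau> j * q x"
    by (rule conditioned_onE[OF c]) (rule that)
  have W: "x \<in> coord_space J" if "x \<in> coord_space I" for x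
    using that \<open>I \<subseteq> J\<close> by (auto simp: coord_space_def)
  show ?thesis
    unfolding conditioned_on_def
  proof (intro conjI allI impI ballI exI[of _ q] exI[of _ \<tau>])
    fix i
    have "compress I (R i) $ r $ s = compress I (R i) $ s $ r" for r s
      using sym_mat_nth[OF conditioned_entries(4)[OF c]] by (simp add: compress_def)
    then show "sym_mat (if i \<in> I then compress I (R i) else unit_mat i)"
      by (simp add: sym_mat_def) (simp add: transpose_def vec_eq_iff)
  next
    fix i j assume "j \<in> I" "i \<notin> I"
    then show "(if j \<in> I then compress I (R j) else unit_mat j) *v axis i 1 = 0"
      by (simp add: vec_eq_iff matrix_axis_nth compress_def)
  next
    fix x :: "real^'n" assume x: "x \<in> coord_space I"
    show "x \<noteq> 0 \<Longrightarrow> q x > 0" using q W x by blast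
    fix j assume j: "j \<in> I"
    then have "j \<in> J" using \<open>I \<subseteq> J\<close> by blast
    with low[OF this W[OF x]] up[OF this W[OF x]] j
    show "\<tau> j * q x \<le> x \<bullet> ((if j \<in> I then compress I (R j) else unit_mat j) *v x)"
      "x \<bullet> ((if j \<in> I then compress I (R j) else unit_mat j) *v x) \<le> a * \<tau> j * q x"
      by (simp_all add: compress_form[OF x])
  qed (use \<tau> in auto)
qed

text \<open>The reflection along \<open>w - axis j 1\<close> exchanges these two unit vectors, and
  it fixes the axes outside \<open>J\<close> because its direction lies in
  \<open>coord_space J\<close>. If the two vectors coincide, the direction is zero and the identity
  is used instead.\<close>

lemma householder_exists:
  fixes w :: "real^'n"
  assumes w: "w \<in> coord_space J" "w \<bullet> w = 1" and j: "j \<in> J"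
  obtains H where "sym_mat H" "H ** H = mat 1" "H *v w = axis j 1"
    "\<And>i. i \<notin> J \<Longrightarrow> H *v axis i 1 = axis i 1"
proof (cases "w = axis j 1")
  case True
  then show ?thesis by (intro that[of "mat 1"]) (auto simp: sym_mat_def)
next
  case False
  define v where "v = w - axis j 1"
  define s where "s = 2 / (v \<bullet> v)"
  have "v \<bullet> v > 0" using False by (simp add: v_def)
  then have s: "s * (v \<bullet> v) = 2" by (simp add: s_def)
  define H where "H = mat 1 - s *\<^sub>R rank1 v"
  have H: "H *v x = x - (s * (v \<bullet> x)) *\<^sub>R v" for x
    by (simp add: H_def matrix_vector_mult_diff_rdistrib scaleR_matrix_vector_assoc[symmetric] rank1_mult_vec)
  show ?thesis
  proof (rule that)
    show "sym_mat H"
      by (simp add: sym_mat_def H_def vec_eq_iff transpose_def rank1_def mat_def mult.commute eq_commute)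
    show "H ** H = mat 1"
    proof (rule matrix_eqI)
      fix x
      have "s * (v \<bullet> (x - (s * (v \<bullet> x)) *\<^sub>R v)) = s * (v \<bullet> x) - (s * (v \<bullet> v)) * (s * (v \<bullet> x))"
        by (simp add: inner_diff_right algebra_simps)
      then have "s * (v \<bullet> (x - (s * (v \<bullet> x)) *\<^sub>R v)) = - (s * (v \<bullet> x))" using s by simp
      then show "(H ** H) *v x = mat 1 *v x"
        by (simp only: matrix_vector_mul_assoc[symmetric] H) simp
    qed
    \<comment> \<open>As \<open>w\<close> and \<open>axis j 1\<close> are unit vectors, both sides
      equal \<open>2 - 2 * w $ j\<close>.\<close>
    have "v \<bullet> v = 2 * (v \<bullet> w)"
      using w(2) by (simp add: v_def inner_diff_left inner_diff_right inner_axis inner_axis' inner_axis_axis)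
    then have "s * (v \<bullet> w) = 1" using s by simp
    then show "H *v w = axis j 1" by (simp add: H v_def)
    show "H *v axis i 1 = axis i 1" if "i \<notin> J" for i
    proof -
      have "v \<bullet> axis i 1 = w $ i - axis j 1 $ i" by (simp add: v_def inner_axis)
      also have "\<dots> = 0" using w(1) that j by (auto simp: coord_space_def axis_def)
      finally have "v \<bullet> axis i 1 = 0" .
      then show ?thesis by (simp add: H)
    qed
  qed
qed

section \<open>Induction on the dimension\<close>

text \<open>Each matrix contributes trace 1, less the diagonal entry at \<open>j\<close> that
  compression deletes. Over \<open>J\<close> the entries \<open>R i $ j $ j\<close> add up to 1, so
  the total loss is \<open>1 - R j $ j $ j\<close>.\<close>

lemma sum_compressed:
  fixes R :: "'n::finite \<Rightarrow> real^'n^'n" and J :: "'n set" and j :: 'n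
  defines "R' \<equiv> \<lambda>i. if i \<in> J - {j} then compress (J - {j}) (R i) else unit_mat i"
  assumes c: "conditioned_on a J R" and sum: "(\<Sum>i\<in>UNIV. R i) = mat 1"
    and tr: "\<And>i. i \<in> J \<Longrightarrow> trace (R i) = 1" and j: "j \<in> J"
  shows "trace (\<Sum>i\<in>UNIV. R' i) = real CARD('n) - 1 + R j $ j $ j"
proof -
  have tr': "trace (R' i) = 1 - (if i \<in> J - {j} then R i $ j $ j else 0)" for i
  proof (cases "i \<in> J - {j}")
    case True
    have "trace (compress (J - {j}) (R i)) = (\<Sum>r\<in>UNIV. if r \<in> J - {j} then R i $ r $ r else 0)"
      unfolding trace_def by (intro sum.cong) (auto simp: compress_def)
    also have "\<dots> = (\<Sum>r\<in>UNIV - {j}. R i $ r $ r)"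
      using conditioned_entries(1)[OF c] True by (intro sum.mono_neutral_cong_right) auto
    also have "\<dots> = trace (R i) - R i $ j $ j"
      by (simp add: trace_def sum.remove[of UNIV j])
    finally show ?thesis using True tr by (simp add: R'_def)
  qed (auto simp: R'_def trace_rank1 inner_axis_axis)
  have "1 = (\<Sum>i\<in>UNIV. axis j 1 \<bullet> (R i *v axis j 1))"
    unfolding sum_form_mat_1[OF sum] by (simp add: inner_axis_axis)
  also have "\<dots> = (\<Sum>i\<in>J. R i $ j $ j) + (\<Sum>i\<in>-J. (axis j 1 $ i)\<^sup>2)"
    unfolding sum_form_split[OF c] by (simp add: inner_axis' matrix_axis_nth)
  also have "(\<Sum>i\<in>-J. (axis j (1::real) $ i)\<^sup>2) = 0"
    using j by (intro sum.neutral) (auto simp: axis_def)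
  finally have J: "(\<Sum>i\<in>J - {j}. R i $ j $ j) = 1 - R j $ j $ j"
    using sum.remove[of J j "\<lambda>i. R i $ j $ j"] j by simp
  have "trace (\<Sum>i\<in>UNIV. R' i) = (\<Sum>i\<in>UNIV. trace (R' i))"
    by (rule linear_sum[OF linear_trace])
  also have "\<dots> = real CARD('n) - (\<Sum>i\<in>UNIV. if i \<in> J - {j} then R i $ j $ j else 0)"
    by (simp only: tr' sum_subtractf) simp
  also have "(\<Sum>i\<in>UNIV. if i \<in> J - {j} then R i $ j $ j else 0) = (\<Sum>i\<in>J - {j}. R i $ j $ j)"
    by (intro sum.mono_neutral_cong_right) auto
  finally show ?thesis using J by simp
qed

text \<open>A reflection turns \<open>rank1 w\<close> into \<open>unit_mat j\<close>, so that \<open>j\<close> leaves the index set; the remaining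
  matrices then add up to the identity minus the compression of \<open>P j\<close> to \<open>w\<close>'s orthogonal complement.\<close>

lemma rank1_deletion_bound:
  fixes P :: "'n::finite \<Rightarrow> real^'n^'n"
  assumes c: "conditioned_on a J P" and sum: "(\<Sum>i\<in>UNIV. P i) = mat 1"
    and tr: "\<And>i. i \<in> J \<Longrightarrow> trace (P i) = 1" and j: "j \<in> J"
    and w: "w \<in> coord_space J" "w \<bullet> w = 1" and C: "C \<ge> 0"
    and IH: "\<And>R. conditioned_on a (J - {j}) R \<Longrightarrow> mixed_discr R \<le> C * det (\<Sum>i\<in>UNIV. R i)"
  shows "mixed_discr (P(j := rank1 w)) \<le> C * exp (w \<bullet> (P j *v w) - 1)"
proof -
  obtain H where H: "sym_mat H" "H ** H = mat 1" "H *v w = axis j 1"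
    "\<And>i. i \<notin> J \<Longrightarrow> H *v axis i 1 = axis i 1"
    using householder_exists[OF w j] by blast
  have HT: "transpose H = H" using H(1) by (simp add: sym_mat_def)
  define R where "R i = H ** P i ** H" for i
  define R' where "R' = (\<lambda>i. if i \<in> J - {j} then compress (J - {j}) (R i) else unit_mat i)"
  have cR: "conditioned_on a J R"
    using conditioned_congruence[OF c H(1,2,4), of "\<lambda>_. 1"] by (simp add: R_def[abs_def])
  then have cR': "conditioned_on a (J - {j}) R'"
    unfolding R'_def by (rule conditioned_restrict) auto
  have detH: "det H * det H = 1" using arg_cong[OF H(2), of det] by (simp add: det_mul)
  have "mixed_discr (P(j := rank1 w)) = det H * mixed_discr (P(j := rank1 w)) * det H"
    using detH by (simp add: mult_ac)
  also have "\<dots> = mixed_discr (\<lambda>i. H ** (P(j := rank1 w)) i ** H)"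
    by (rule mixed_discr_congruence[symmetric])
  also have "\<dots> = mixed_discr R'"
  proof (rule mixed_discr_compress)
    fix i assume i: "i \<notin> J - {j}"
    show "H ** (P(j := rank1 w)) i ** H = unit_mat i"
    proof (cases "i = j")
      case True
      then show ?thesis using rank1_congruence[of H w] HT H(3) by simp
    next
      case False
      then have "i \<notin> J" using i by blast
      then show ?thesis using rank1_congruence[of H "axis i 1"] HT H(4) False
          conditioned_entries(3)[OF c] by simp
    qed
  qed (auto simp: R'_def R_def)
  also have "\<dots> \<le> C * det (\<Sum>i\<in>UNIV. R' i)" by (rule IH[OF cR'])
  also have "\<dots> \<le> C * exp (trace (\<Sum>i\<in>UNIV. R' i) - real CARD('n))"
    using pos_semidef_sum[of UNIV R' "\<lambda>_. 1"] conditioned_semidef[OF cR']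
    by (intro mult_left_mono det_le_exp_trace C) auto
  also have "trace (\<Sum>i\<in>UNIV. R' i) - real CARD('n) = R j $ j $ j - 1"
  proof -
    have "(\<Sum>i\<in>UNIV. R i) = H ** (\<Sum>i\<in>UNIV. P i) ** H"
      unfolding R_def using sum_congruence[of "\<lambda>_. 1" H P H UNIV] by simp
    then have "(\<Sum>i\<in>UNIV. R i) = mat 1" by (simp add: sum H(2))
    moreover have "trace (R i) = 1" if "i \<in> J" for i
    proof -
      have "trace (R i) = trace (H ** (H ** P i))" unfolding R_def by (rule trace_mul_sym)
      then show ?thesis using tr[OF that] by (simp add: matrix_mul_assoc H(2))
    qed
    ultimately show ?thesis
      using sum_compressed[OF cR _ _ j] by (simp add: R'_def)
  qed
  also have "R j $ j $ j = w \<bullet> (P j *v w)"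
  proof -
    have Hj: "H *v axis j 1 = w"
      by (simp add: H(3)[symmetric] matrix_vector_mul_assoc H(2))
    have "R j $ j $ j = axis j 1 \<bullet> (R j *v axis j 1)"
      by (simp add: inner_axis' matrix_axis_nth)
    also have "\<dots> = (H *v axis j 1) \<bullet> (P j *v (H *v axis j 1))"
      by (simp add: R_def matrix_vector_mul_assoc[symmetric] sym_mat_inner[OF H(1)])
    finally show ?thesis by (simp add: Hj)
  qed
  finally show ?thesis .
qed

text \<open>Expanding slot \<open>j\<close> along the spectral decomposition of \<open>P j\<close>
  makes \<open>mixed_discr P\<close> an average with weights \<open>\<mu> l\<close>, which sum to
  the trace 1. Each contributing eigenvalue is at most 1 by the trace and at most
  \<open>a\<^sup>2 / real (card J)\<close> by the form bound, so one estimate serves all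
  terms.\<close>

lemma doubly_stochastic_step:
  fixes P :: "'n::finite \<Rightarrow> real^'n^'n"
  assumes c: "conditioned_on a J P" and sum: "(\<Sum>i\<in>UNIV. P i) = mat 1"
    and tr: "\<And>i. i \<in> J \<Longrightarrow> trace (P i) = 1" and j: "j \<in> J" and C: "C \<ge> 0" and a: "a \<ge> 0"
    and IH: "\<And>R. conditioned_on a (J - {j}) R \<Longrightarrow> mixed_discr R \<le> C * det (\<Sum>i\<in>UNIV. R i)"
  shows "mixed_discr P \<le> C * exp (min 1 (a\<^sup>2 / real (card J)) - 1)"
proof -
  have sym: "sym_mat (P j)" by (rule conditioned_entries(4)[OF c])
  obtain b \<mu> where b: "orthonormal_family b" "\<And>i. P j *v b i = \<mu> i *\<^sub>R b i"
    using spectral_theorem[OF sym] by blast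
  have nonneg: "\<mu> l \<ge> 0" for l
    using spectral_eigenvalue(1)[OF b] conditioned_semidef[OF c] by (simp add: pos_semidef_mat_def)
  have sum1: "(\<Sum>l\<in>UNIV. \<mu> l) = 1" using spectral_trace[OF b] tr[OF j] by simp
  have bb: "b l \<bullet> b l = 1" for l using b(1) by (simp add: orthonormal_family_def)
  have "\<mu> l * mixed_discr (P(j := rank1 (b l))) \<le> \<mu> l * (C * exp (min 1 (a\<^sup>2 / real (card J)) - 1))" for l
  proof (cases "\<mu> l = 0")
    case False
    \<comment> \<open>An eigenvector with nonzero eigenvalue lies in the range of
      \<open>P j\<close>, hence in \<open>coord_space J\<close>. For eigenvalue 0 this may fail, but
      that term vanishes.\<close>
    have W: "b l \<in> coord_space J"
      unfolding coord_space_def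
    proof (intro CollectI allI impI)
      fix i assume "i \<notin> J"
      then have "(P j *v b l) $ i = 0"
        using conditioned_entries(2)[OF c j] by (simp add: matrix_vector_mult_def)
      then show "b l $ i = 0" using b(2)[of l] False by simp
    qed
    have "\<mu> l \<le> 1" using sum1 nonneg member_le_sum[of l UNIV \<mu>] by simp
    moreover have "\<mu> l \<le> a\<^sup>2 / real (card J)"
      using doubly_stochastic_form_le[OF c sum tr[OF j] j W a] spectral_eigenvalue(1)[OF b(1) b(2), of l] bb
      by simp
    ultimately have "exp (b l \<bullet> (P j *v b l) - 1) \<le> exp (min 1 (a\<^sup>2 / real (card J)) - 1)"
      using spectral_eigenvalue(1)[OF b(1) b(2), of l] by simp
    then have "C * exp (b l \<bullet> (P j *v b l) - 1) \<le> C * exp (min 1 (a\<^sup>2 / real (card J)) - 1)"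
      using C by (rule mult_left_mono)
    then show ?thesis
      using rank1_deletion_bound[OF c sum tr j W bb C IH]
      by (intro mult_left_mono nonneg) (rule order_trans)
  qed simp
  then have "(\<Sum>l\<in>UNIV. \<mu> l * mixed_discr (P(j := rank1 (b l)))) \<le>
      (\<Sum>l\<in>UNIV. \<mu> l * (C * exp (min 1 (a\<^sup>2 / real (card J)) - 1)))"
    by (rule sum_mono)
  then show ?thesis
    using mixed_discr_sum[where Q = P and j = j, OF spectral_decomposition[OF b] finite] sum1
    by (simp add: sum_distrib_right[symmetric])
qed

lemma sum_unit_mat: "(\<Sum>i\<in>UNIV. unit_mat i) = (mat 1 :: real^'n^'n)"
proof -
  have "(\<Sum>i\<in>UNIV. if r = i \<and> s = i then 1 else 0) = (if r = s then 1 else 0 :: real)" for r s :: 'n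
  proof -
    have "(\<Sum>i\<in>UNIV. if r = i \<and> s = i then 1 else 0) = (\<Sum>i\<in>UNIV. if i = r then (if r = s then 1 else 0) else 0 :: real)"
      by (intro sum.cong) auto
    then show ?thesis by simp
  qed
  then show ?thesis by (simp add: vec_eq_iff unit_mat_nth mat_def)
qed

text \<open>Every permutation other than the identity produces a zero row. The value anchors the
  induction at the empty index set.\<close>

lemma mixed_discr_unit_mat: "mixed_discr (unit_mat :: 'n::finite \<Rightarrow> _) = 1"
proof -
  have "mixed_discr (unit_mat :: 'n \<Rightarrow> _) = (\<Sum>p\<in>{id :: 'n \<Rightarrow> 'n}. det (\<chi> r. unit_mat (p r) $ r))"
    unfolding mixed_discr_eq
  proof (rule sum.mono_neutral_right)
    show "\<forall>p\<in>{p :: 'n \<Rightarrow> 'n. p permutes UNIV} - {id}. det (\<chi> r. unit_mat (p r) $ r) = 0"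
    proof
      fix p :: "'n \<Rightarrow> 'n" assume "p \<in> {p. p permutes UNIV} - {id}"
      then obtain r where "p r \<noteq> r" by (auto simp: fun_eq_iff)
      then have "row r (\<chi> r. unit_mat (p r) $ r) = 0" by (simp add: row_def vec_eq_iff unit_mat_nth)
      then show "det (\<chi> r. unit_mat (p r) $ r) = 0" by (rule det_zero_row)
    qed
  qed (auto simp: permutes_id)
  moreover have "(\<chi> r. unit_mat r $ r) = (mat 1 :: real^'n^'n)" by (simp add: vec_eq_iff unit_mat_nth mat_def)
  ultimately show ?thesis by simp
qed

text \<open>The minimum with \<open>1\<close> makes the factor for \<open>i = 1\<close> equal to \<open>1\<close>, which allows the induction to
  start from the empty index set.\<close>

definition bound_const :: "real \<Rightarrow> nat \<Rightarrow> real" where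
  "bound_const a k = (\<Prod>i=1..k. exp (min 1 (a\<^sup>2 / real i) - 1))"

text \<open>The capacity is an infimum over weights, so a bound by it is stated for every admissible
  \<open>s\<close>. Normalising at a minimiser \<open>t\<close> gives a tuple \<open>P\<close> to
  which the one-index deletion step applies; the induction hypothesis is then needed only with all
  weights 1.\<close>

lemma mixed_discr_capacity_bound:
  fixes R :: "'n::finite \<Rightarrow> real^'n^'n"
  assumes "conditioned_on a J R" "\<And>i. s i > 0" "\<And>i. i \<notin> J \<Longrightarrow> s i = 1" and a: "a \<ge> 0"
  shows "mixed_discr R * (\<Prod>i\<in>UNIV. s i) \<le> bound_const a (card J) * det (\<Sum>i\<in>UNIV. s i *\<^sub>R R i)"
  using assms(1-3)
proof (induction "card J" arbitrary: J R s)
  case 0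
  then have "J = {}" by simp
  then have s: "s i = 1" and R: "R i = unit_mat i" for i
    using 0 conditioned_entries(3)[of a J R i] by auto
  have sum: "(\<Sum>i\<in>UNIV. R i) = mat 1" by (simp add: R sum_unit_mat)
  have "R = unit_mat" using R by blast
  then have "mixed_discr R = det (\<Sum>i\<in>UNIV. R i)" using sum mixed_discr_unit_mat by simp
  then show ?case using s \<open>0 = card J\<close> by (simp add: bound_const_def)
next
  case (Suc k)
  then have "J \<noteq> {}" by auto
  then obtain j where j: "j \<in> J" by blast
  note c = Suc.prems(1)
  obtain t where t: "\<And>i. t i > 0" "\<And>i. i \<notin> J \<Longrightarrow> t i = 1"
    and min: "\<And>s. (\<And>i. s i > 0) \<Longrightarrow> (\<And>i. i \<notin> J \<Longrightarrow> s i = 1) \<Longrightarrow>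
      det (\<Sum>i\<in>UNIV. t i *\<^sub>R R i) * (\<Prod>i\<in>UNIV. s i) \<le> det (\<Sum>i\<in>UNIV. s i *\<^sub>R R i) * (\<Prod>i\<in>UNIV. t i)"
    using capacity_attained[OF c \<open>J \<noteq> {}\<close>] by blast
  define S where "S = (\<Sum>i\<in>UNIV. t i *\<^sub>R R i)"
  have S: "pos_def_mat S"
    unfolding S_def by (rule conditioned_pos_def[where t = t, OF c less_imp_le[OF t(1)] t(2) j t(1)])
  obtain T where T: "sym_mat T" "T ** S ** T = mat 1" "\<And>x. S *v x = x \<Longrightarrow> T *v x = x"
    using inverse_square_root_exists[OF S] by blast
  \<comment> \<open>The padding weights are 1 and each \<open>R k\<close> with \<open>k\<close> in
    \<open>J\<close> annihilates these axes, so \<open>S\<close> fixes them, and so does its inverse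
    square root.\<close>
  have fix_T: "T *v axis i 1 = axis i 1" if i: "i \<notin> J" for i
  proof (rule T(3))
    have "t k *\<^sub>R (R k *v axis i 1) = (if k = i then axis i 1 else 0)" for k
    proof (cases "k \<in> J")
      case True
      then show ?thesis using c i by (auto simp: conditioned_on_def)
    next
      case False
      then show ?thesis using t(2) conditioned_entries(3)[OF c False]
        by (simp add: rank1_mult_vec inner_axis_axis)
    qed
    then show "S *v axis i 1 = axis i 1"
      by (simp add: S_def sum_scaleR_matrix_vec)
  qed
  define P where "P i = t i *\<^sub>R (T ** R i ** T)" for i
  have cP: "conditioned_on a J P"
    unfolding P_def[abs_def] using T(2) by (rule conditioned_congruence[OF c T(1) _ fix_T t])
  have sum_P: "(\<Sum>i\<in>UNIV. u i *\<^sub>R P i) = T ** (\<Sum>i\<in>UNIV. (u i * t i) *\<^sub>R R i) ** T" for u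
    unfolding P_def by (simp add: sum_congruence[symmetric])
  have sum: "(\<Sum>i\<in>UNIV. P i) = mat 1"
    using sum_P[of "\<lambda>_. 1"] T(2) by (simp add: S_def)
  have "det (T ** S ** T) = 1" by (simp add: T(2))
  then have dT: "det T * det S * det T = 1" by (simp only: det_mul)
  have dS: "det S > 0" by (rule pos_def_det_pos[OF S])
  have pt: "(\<Prod>i\<in>UNIV. t i) > 0" using t by (intro prod_pos) auto
  \<comment> \<open>Inserting the weights \<open>u i * t i\<close> into the minimality of
    \<open>t\<close> shows that the ratio for \<open>P\<close> has minimum 1, attained when all
    weights are 1.\<close>
  have cap: "(\<Prod>i\<in>UNIV. u i) \<le> det (\<Sum>i\<in>UNIV. u i *\<^sub>R P i)"
    if u: "\<And>i. u i > 0" "\<And>i. i \<notin> J \<Longrightarrow> u i = 1" for u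
  proof -
    let ?M = "\<Sum>i\<in>UNIV. (u i * t i) *\<^sub>R R i"
    have "det S * (\<Prod>i\<in>UNIV. u i * t i) \<le> det ?M * (\<Prod>i\<in>UNIV. t i)"
      unfolding S_def using u t by (intro min) auto
    then have "(det S * (\<Prod>i\<in>UNIV. u i)) * (\<Prod>i\<in>UNIV. t i) \<le> det ?M * (\<Prod>i\<in>UNIV. t i)"
      by (simp add: prod.distrib mult_ac)
    then have "det S * (\<Prod>i\<in>UNIV. u i) \<le> det ?M" using pt by (simp only: mult_le_cancel_right_pos)
    then have "(det T)\<^sup>2 * (det S * (\<Prod>i\<in>UNIV. u i)) \<le> (det T)\<^sup>2 * det ?M"
      by (rule mult_left_mono) simp
    moreover have "(det T)\<^sup>2 * (det S * (\<Prod>i\<in>UNIV. u i)) = (det T * det S * det T) * (\<Prod>i\<in>UNIV. u i)"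
      by (simp only: power2_eq_square mult_ac)
    moreover have "det (\<Sum>i\<in>UNIV. u i *\<^sub>R P i) = (det T)\<^sup>2 * det ?M"
      by (simp only: sum_P det_mul power2_eq_square mult_ac)
    ultimately show ?thesis by (simp only: dT mult_1)
  qed
  have tr: "trace (P i) = 1" if "i \<in> J" for i
  proof (rule trace_eq_1_if_capacity[OF conditioned_semidef[OF cP] sum])
    fix u :: "'n \<Rightarrow> real" assume u: "\<And>k. u k > 0" "\<And>k. k \<noteq> i \<Longrightarrow> u k = 1"
    show "(\<Prod>i\<in>UNIV. u i) \<le> det (\<Sum>i\<in>UNIV. u i *\<^sub>R P i)"
    proof (rule cap[OF u(1)])
      show "u k = 1" if "k \<notin> J" for k using \<open>i \<in> J\<close> that by (intro u(2)) auto
    qed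
  qed
  have k: "k = card (J - {j})" using Suc.hyps(2) j by simp
  have "mixed_discr P \<le> bound_const a k * exp (min 1 (a\<^sup>2 / real (card J)) - 1)"
  proof (rule doubly_stochastic_step[OF cP sum tr j _ a])
    show "bound_const a k \<ge> 0" by (simp add: bound_const_def prod_nonneg)
    show "mixed_discr R' \<le> bound_const a k * det (\<Sum>i\<in>UNIV. R' i)" if "conditioned_on a (J - {j}) R'" for R'
      using Suc.hyps(1)[OF k that, of "\<lambda>_. 1"] k by simp
  qed
  also have "\<dots> = bound_const a (card J)"
    unfolding Suc.hyps(2)[symmetric] by (simp add: bound_const_def)
  finally have DP: "mixed_discr P \<le> bound_const a (card J)" .
  \<comment> \<open>The factor from scaling and congruence is the reciprocal of the capacity of
    \<open>R\<close>, because \<open>(det T)\<^sup>2 * det S = 1\<close>.\<close>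
  have "mixed_discr P = (\<Prod>i\<in>UNIV. t i) * (det T * mixed_discr R * det T)"
    unfolding P_def[abs_def] mixed_discr_scale mixed_discr_congruence ..
  then have "mixed_discr P * det S = (det T * det S * det T) * (mixed_discr R * (\<Prod>i\<in>UNIV. t i))"
    by (simp only: mult_ac)
  then have DR: "mixed_discr R * (\<Prod>i\<in>UNIV. t i) = mixed_discr P * det S" using dT by simp
  have ps: "(\<Prod>i\<in>UNIV. s i) > 0" using Suc.prems by (intro prod_pos) auto
  have "(mixed_discr R * (\<Prod>i\<in>UNIV. s i)) * (\<Prod>i\<in>UNIV. t i) = mixed_discr P * (det S * (\<Prod>i\<in>UNIV. s i))"
    using DR by (simp add: mult_ac)
  also have "\<dots> \<le> bound_const a (card J) * (det S * (\<Prod>i\<in>UNIV. s i))"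
    using DP dS ps by (intro mult_right_mono) auto
  also have "\<dots> \<le> bound_const a (card J) * (det (\<Sum>i\<in>UNIV. s i *\<^sub>R R i) * (\<Prod>i\<in>UNIV. t i))"
    unfolding S_def using Suc.prems
    by (intro mult_left_mono min) (auto simp: bound_const_def prod_nonneg)
  finally have "(mixed_discr R * (\<Prod>i\<in>UNIV. s i)) * (\<Prod>i\<in>UNIV. t i) \<le>
      (bound_const a (card J) * det (\<Sum>i\<in>UNIV. s i *\<^sub>R R i)) * (\<Prod>i\<in>UNIV. t i)"
    by (simp only: mult.assoc)
  then show ?case using pt by (simp only: mult_le_cancel_right_pos)
qed

section \<open>Estimating the constant and comparing \<alpha>-conditioned tuples with a common
  form\<close>

text \<open>The factor for \<open>i = 1\<close> is 1, and each later one is at most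
  \<open>exp (a\<^sup>2 / real i - 1)\<close>. Since 1 / (k + 1) \<le> ln ((k + 1) / k), the sum of
  the reciprocals from 2 to k telescopes to at most ln k.\<close>

lemma bound_const_le:
  assumes "a \<ge> 1" "k \<ge> 1"
  shows "bound_const a k \<le> real k powr a\<^sup>2 * exp (- (real k - 1))"
  using assms(2)
proof (induction k rule: dec_induct)
  case base
  then show ?case by (simp add: bound_const_def)
next
  case (step k)
  have "1 / real (Suc k) \<le> ln (real (Suc k) / real k)"
  proof -
    have "ln (real k / real (Suc k)) \<le> real k / real (Suc k) - 1"
      using step by (intro ln_le_minus_one) auto
    moreover have "real k / real (Suc k) - 1 = - (1 / real (Suc k))" by (simp add: field_simps)
    moreover have "ln (real k / real (Suc k)) = - ln (real (Suc k) / real k)"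
      using step by (simp add: ln_div)
    ultimately show ?thesis by linarith
  qed
  then have "a\<^sup>2 * (1 / real (Suc k)) \<le> a\<^sup>2 * ln (real (Suc k) / real k)" by (rule mult_left_mono) simp
  then have le: "exp (min 1 (a\<^sup>2 / real (Suc k)) - 1) \<le> exp (a\<^sup>2 * ln (real (Suc k) / real k) - 1)"
    by simp
  have "bound_const a (Suc k) = bound_const a k * exp (min 1 (a\<^sup>2 / real (Suc k)) - 1)"
    by (simp add: bound_const_def)
  also have "\<dots> \<le> (real k powr a\<^sup>2 * exp (- (real k - 1))) * exp (a\<^sup>2 * ln (real (Suc k) / real k) - 1)"
    by (intro mult_mono step.IH le) auto
  also have "\<dots> = real (Suc k) powr a\<^sup>2 * exp (- (real (Suc k) - 1))"
    using step(1) by (simp add: powr_def exp_add[symmetric] ln_div algebra_simps)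
  finally show ?case .
qed

text \<open>\<open>c\<close> is the smallest eigenvalue in the whole tuple, attained by some
  \<open>Q j\<close>. Conditioning compares every \<open>lambda_max (Q i)\<close> with this same
  \<open>j\<close>, so one constant serves all matrices.\<close>

lemma alpha_conditioned_uniform_bounds:
  fixes Q :: "'n::finite \<Rightarrow> real^'n^'n"
  assumes "alpha_conditioned \<alpha> Q"
  obtains c where "c > 0" "\<And>i x. c * (x \<bullet> x) \<le> x \<bullet> (Q i *v x)"
    "\<And>i x. x \<bullet> (Q i *v x) \<le> \<alpha> * c * (x \<bullet> x)"
proof -
  have pd: "pos_def_mat (Q i)" and cond: "lambda_max (Q i) \<le> \<alpha> * lambda_min (Q j)" for i j
    using assms by (auto simp: alpha_conditioned_def)
  then have sym: "sym_mat (Q i)" for i by (auto simp: pos_def_mat_def)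
  define c where "c = Min (range (\<lambda>i. lambda_min (Q i)))"
  have "c \<in> range (\<lambda>i. lambda_min (Q i))" unfolding c_def by (rule Min_in) auto
  then obtain j where j: "c = lambda_min (Q j)" by auto
  have le: "c \<le> lambda_min (Q i)" for i unfolding c_def by (rule Min_le) auto
  \<comment> \<open>An eigenvector for \<open>c\<close> transfers the positivity of
    \<open>Q j\<close> to \<open>c\<close>.\<close>
  obtain v where v: "v \<noteq> 0" "Q j *v v = c *\<^sub>R v"
    using eigenvalues_bounds(3)[OF sym[of j]] unfolding j eigenvalues_mat_def by blast
  then have "c * (v \<bullet> v) > 0" using pd[of j] by (auto simp: pos_def_mat_def)
  then have "c > 0" by (rule zero_less_mult_pos2) (use v(1) in simp)
  moreover have "c * (x \<bullet> x) \<le> x \<bullet> (Q i *v x)" for i x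
    by (rule order_trans[OF mult_right_mono[OF le] eigenvalues_bounds(1)[OF sym]]) simp
  moreover have "x \<bullet> (Q i *v x) \<le> \<alpha> * c * (x \<bullet> x)" for i x
    unfolding j
    by (rule order_trans[OF eigenvalues_bounds(2)[OF sym] mult_right_mono[OF cond]]) simp
  ultimately show ?thesis by (rule that)
qed

theorem theorem1p6:
  fixes Q P :: "'n::finite \<Rightarrow> real^'n^'n" and \<alpha> :: real
    and T :: "real^'n^'n" and \<tau> :: "'n \<Rightarrow> real"
  assumes "\<alpha> \<ge> 1"
    and "alpha_conditioned \<alpha> Q"
    and "\<forall>i. pos_def_mat (Q i)"
    and "doubly_stochastic P"
    and "\<forall>i. pos_def_mat (P i)"
    and "invertible T"
    and "\<forall>i. \<tau> i > 0"
    and "\<forall>i. P i = \<tau> i *\<^sub>R (transpose T ** Q i ** T)"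
  shows "mixed_discr P \<le> real CARD('n) powr (\<alpha> ^ 4) * exp (- (real CARD('n) - 1))"
proof -
  obtain c where c: "c > 0" "\<And>i x. c * (x \<bullet> x) \<le> x \<bullet> (Q i *v x)"
    "\<And>i x. x \<bullet> (Q i *v x) \<le> \<alpha> * c * (x \<bullet> x)"
    using alpha_conditioned_uniform_bounds[OF assms(2)] by blast
  have form: "x \<bullet> (P i *v x) = \<tau> i * ((T *v x) \<bullet> (Q i *v (T *v x)))" for i x
  proof -
    have "x \<bullet> (transpose T *v y) = (T *v x) \<bullet> y" for y
      by (simp only: dot_lmul_matrix[symmetric] vector_transpose_matrix)
    then show ?thesis
      by (simp add: assms(8) scaleR_matrix_vector_assoc[symmetric] matrix_vector_mul_assoc[symmetric]
          del: transpose_matrix_vector)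
  qed
  have nz: "T *v x \<noteq> 0" if "x \<noteq> 0" for x
  proof
    assume "T *v x = 0"
    moreover obtain U where "U ** T = mat 1" using assms(6) unfolding invertible_def by blast
    then have "U *v (T *v x) = x" by (simp add: matrix_vector_mul_assoc)
    ultimately show False using that by simp
  qed
  \<comment> \<open>The common form is the squared norm pulled back by \<open>T\<close>, and
    \<open>\<tau> i * c\<close> absorbs the scaling, so the constant stays \<alpha> for every
    invertible \<open>T\<close>.\<close>
  have "conditioned_on \<alpha> UNIV P"
    unfolding conditioned_on_def
  proof (intro conjI allI impI ballI exI[of _ "\<lambda>x. (T *v x) \<bullet> (T *v x)"] exI[of _ "\<lambda>i. \<tau> i * c"])
    show "sym_mat (P i)" for i using assms(5) by (simp add: pos_def_mat_def)
    show "\<tau> i * c > 0" for i using assms(7) c(1) by simp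
    show "(T *v x) \<bullet> (T *v x) > 0" if "x \<noteq> 0" for x using nz[OF that] by simp
    show "\<tau> i * c * ((T *v x) \<bullet> (T *v x)) \<le> x \<bullet> (P i *v x)" for i x
      using mult_left_mono[OF c(2), of "\<tau> i"] assms(7) by (simp add: form less_imp_le mult_ac)
    show "x \<bullet> (P i *v x) \<le> \<alpha> * (\<tau> i * c) * ((T *v x) \<bullet> (T *v x))" for i x
      using mult_left_mono[OF c(3), of "\<tau> i"] assms(7) by (simp add: form less_imp_le mult_ac)
  qed auto
  \<comment> \<open>With all weights 1 the determinant on the right is that of the identity.\<close>
  from mixed_discr_capacity_bound[OF this, of "\<lambda>_. 1"]
  have "mixed_discr P \<le> bound_const \<alpha> CARD('n)"
    using assms(1,4) by (simp add: doubly_stochastic_def)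
  also have "\<dots> \<le> real CARD('n) powr \<alpha>\<^sup>2 * exp (- (real CARD('n) - 1))"
    using assms(1) by (intro bound_const_le) (auto simp: Suc_le_eq)
  \<comment> \<open>The exponent may grow from \<open>\<alpha>\<^sup>2\<close> to
    \<open>\<alpha> ^ 4\<close> because \<alpha> and the dimension are both at least 1.\<close>
  also have "\<dots> \<le> real CARD('n) powr (\<alpha> ^ 4) * exp (- (real CARD('n) - 1))"
    using assms(1) by (intro mult_right_mono powr_mono power_increasing) (auto simp: Suc_le_eq)
  finally show ?thesis .
qed

end
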